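(* Let $h\in L^0(M,N)$. Suppose that $\mu_M$ is not purely infinite and that $N$ is separable. Then the following assertions are equivalent: (i) $L^2_h(M,N)$ is a global NNC (resp. NPC) space; (ii) $N$ is a global NNC (resp. NPC) space.
   Context: Setting: $(M,\Sigma_M,\mu_M)$ is a measure space with $M$ nonempty and $(N,d_N)$ is a nonempty metric space with finite metric. $\mu_M$ is purely infinite if $\mu_M(A)\in\{0,\infty\}$ for every measurable set $A$. $L^0(M,N)$ is the set of $\mu_M$-a.e.-equality classes of measurable maps $M\to N$ (Borel $\sigma$-algebra on $N$) with separable range. For $h\in L^0(M,N)$, $L^2_h(M,N)$ is the set of $f\in L^0(M,N)$ with $D_2(f,h)<\infty$, with the metric $D_2(f,f')=(\int_M d_N(f(x),f'(x))^2\,d\mu_M(x))^{1/2}$. A metric space $(X,d_X)$ is geodesic if any two points $x,x'$ are joined by an absolutely continuous curve of length $d_X(x,x')$ (length $=$ integral of the metric derivative). A constant speed geodesic is a curve $\gamma:[0,1]\to X$ with $d_X(\gamma(s),\gamma(t))=|t-s|\,d_X(\gamma(0),\gamma(1))$ for all $s,t\in[0,1]$. A complete geodesic space $X$ is a global NNC space (nonnegative curvature in the sense of Alexandrov) if for every $z\in X$ and every constant speed geodesic $\gamma:[0,1]\to X$, $$d_X(z,\gamma(t))^2\ge(1-t)\,d_X(z,\gamma(0))^2+t\,d_X(z,\gamma(1))^2-(1-t)t\,d_X(\gamma(0),\gamma(1))^2\quad\text{for all }t\in[0,1],$$ and a global NPC space (nonpositive curvature) if the converse inequality $\le$ holds for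 all such $z,\gamma,t$. Completeness and geodesicity are part of the definition of global NNC and NPC spaces. *)

theory Defs
  imports "HOL-Analysis.Analysis"
begin

section \<open>Geodesic spaces and global curvature bounds\<close>

text \<open>
  A metric space is a carrier set \<open>X\<close> with a distance \<open>d\<close>. A curve \<open>[0,1] \<rightarrow> X\<close> is a total function
  on \<^typ>\<open>real\<close> that maps \<open>{0..1}\<close> into \<open>X\<close>; its values outside \<open>{0..1}\<close> are never used.
\<close>

definition absolutely_continuous_curve ::
    "'a set \<Rightarrow> ('a \<Rightarrow> 'a \<Rightarrow> real) \<Rightarrow> (real \<Rightarrow> 'a) \<Rightarrow> bool" where
  "absolutely_continuous_curve X d \<gamma> \<longleftrightarrow>
     \<gamma> ` {0..1} \<subseteq> X \<and>
     (\<exists>g :: real \<Rightarrow> real. integrable (lebesgue_on {0..1}) g \<and>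
        (\<forall>s t. 0 \<le> s \<and> s \<le> t \<and> t \<le> 1 \<longrightarrow> d (\<gamma> s) (\<gamma> t) \<le> (LINT r|lebesgue_on {s..t}. g r)))"

definition has_metric_derivative ::
    "('a \<Rightarrow> 'a \<Rightarrow> real) \<Rightarrow> (real \<Rightarrow> 'a) \<Rightarrow> real \<Rightarrow> real \<Rightarrow> bool" where
  "has_metric_derivative d \<gamma> m t \<longleftrightarrow>
     ((\<lambda>s. d (\<gamma> s) (\<gamma> t) / \<bar>s - t\<bar>) \<longlongrightarrow> m) (at t within {0..1})"

text \<open>
  The length of an absolutely continuous curve is the integral of its metric derivative. The metric
  derivative of such a curve exists almost everywhere, so the almost-everywhere clause excludes no
  absolutely continuous curve.
\<close>

definition has_curve_length ::
    "('a \<Rightarrow> 'a \<Rightarrow> real) \<Rightarrow> (real \<Rightarrow> 'a) \<Rightarrow> real \<Rightarrow> bool" where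
  "has_curve_length d \<gamma> l \<longleftrightarrow>
     (\<exists>m. (AE t in lebesgue_on {0..1}. has_metric_derivative d \<gamma> (m t) t) \<and>
          has_bochner_integral (lebesgue_on {0..1}) m l)"

definition geodesic_space :: "'a set \<Rightarrow> ('a \<Rightarrow> 'a \<Rightarrow> real) \<Rightarrow> bool" where
  "geodesic_space X d \<longleftrightarrow> Metric_space X d \<and>
     (\<forall>x\<in>X. \<forall>y\<in>X. \<exists>\<gamma>. absolutely_continuous_curve X d \<gamma> \<and> \<gamma> 0 = x \<and> \<gamma> 1 = y \<and>
        has_curve_length d \<gamma> (d x y))"

definition constant_speed_geodesic ::
    "'a set \<Rightarrow> ('a \<Rightarrow> 'a \<Rightarrow> real) \<Rightarrow> (real \<Rightarrow> 'a) \<Rightarrow> bool" where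
  "constant_speed_geodesic X d \<gamma> \<longleftrightarrow>
     \<gamma> ` {0..1} \<subseteq> X \<and>
     (\<forall>s\<in>{0..1}. \<forall>t\<in>{0..1}. d (\<gamma> s) (\<gamma> t) = \<bar>t - s\<bar> * d (\<gamma> 0) (\<gamma> 1))"

definition global_NNC :: "'a set \<Rightarrow> ('a \<Rightarrow> 'a \<Rightarrow> real) \<Rightarrow> bool" where
  "global_NNC X d \<longleftrightarrow>
     Metric_space X d \<and> Metric_space.mcomplete X d \<and> geodesic_space X d \<and>
     (\<forall>z\<in>X. \<forall>\<gamma>. constant_speed_geodesic X d \<gamma> \<longrightarrow>
        (\<forall>t\<in>{0..1}. (d z (\<gamma> t))\<^sup>2 \<ge>
           (1 - t) * (d z (\<gamma> 0))\<^sup>2 + t * (d z (\<gamma> 1))\<^sup>2 - (1 - t) * t * (d (\<gamma> 0) (\<gamma> 1))\<^sup>2))"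

definition global_NPC :: "'a set \<Rightarrow> ('a \<Rightarrow> 'a \<Rightarrow> real) \<Rightarrow> bool" where
  "global_NPC X d \<longleftrightarrow>
     Metric_space X d \<and> Metric_space.mcomplete X d \<and> geodesic_space X d \<and>
     (\<forall>z\<in>X. \<forall>\<gamma>. constant_speed_geodesic X d \<gamma> \<longrightarrow>
        (\<forall>t\<in>{0..1}. (d z (\<gamma> t))\<^sup>2 \<le>
           (1 - t) * (d z (\<gamma> 0))\<^sup>2 + t * (d z (\<gamma> 1))\<^sup>2 - (1 - t) * t * (d (\<gamma> 0) (\<gamma> 1))\<^sup>2))"


section \<open>The spaces \<open>L\<^sup>0(M, N)\<close> and \<open>L\<^sup>2\<^sub>h(M, N)\<close>\<close>

definition purely_infinite :: "'m measure \<Rightarrow> bool" where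
  "purely_infinite M \<longleftrightarrow> (\<forall>A\<in>sets M. emeasure M A \<in> {0, \<infinity>})"

definition L0_maps :: "'m measure \<Rightarrow> ('m \<Rightarrow> 'n::metric_space) set" where
  "L0_maps M = {f \<in> borel_measurable M. separable_space (top_of_set (f ` space M))}"

definition ae_rel :: "'m measure \<Rightarrow> (('m \<Rightarrow> 'n::metric_space) \<times> ('m \<Rightarrow> 'n)) set" where
  "ae_rel M = {(f, g). f \<in> L0_maps M \<and> g \<in> L0_maps M \<and> (AE x in M. f x = g x)}"

definition L0 :: "'m measure \<Rightarrow> ('m \<Rightarrow> 'n::metric_space) set set" where
  "L0 M = L0_maps M // ae_rel M"

text \<open>
  \<open>D2\<close> takes values in \<open>[0,\<infinity>]\<close>; the case distinction is the square root on \<open>[0,\<infinity>]\<close>.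
\<close>

definition D2_maps :: "'m measure \<Rightarrow> ('m \<Rightarrow> 'n::metric_space) \<Rightarrow> ('m \<Rightarrow> 'n) \<Rightarrow> ennreal" where
  "D2_maps M f g =
     (let I = (\<integral>\<^sup>+ x. ennreal ((dist (f x) (g x))\<^sup>2) \<partial>M)
      in if I = \<infinity> then \<infinity> else ennreal (sqrt (enn2real I)))"

text \<open>
  On classes, \<open>D2\<close> is the common value of \<open>D2_maps\<close> on all pairs of representatives.
\<close>

definition D2 :: "'m measure \<Rightarrow> ('m \<Rightarrow> 'n::metric_space) set \<Rightarrow> ('m \<Rightarrow> 'n) set \<Rightarrow> ennreal" where
  "D2 M F G = the_elem ((\<lambda>(f, g). D2_maps M f g) ` (F \<times> G))"

definition L2 :: "'m measure \<Rightarrow> ('m \<Rightarrow> 'n::metric_space) set \<Rightarrow> ('m \<Rightarrow> 'n) set set" where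
  "L2 M h = {F \<in> L0 M. D2 M F h < \<infinity>}"

definition L2_dist :: "'m measure \<Rightarrow> ('m \<Rightarrow> 'n::metric_space) set \<Rightarrow> ('m \<Rightarrow> 'n) set \<Rightarrow> real" where
  "L2_dist M F G = enn2real (D2 M F G)"


text \<open>
  \<^const>\<open>ae_rel\<close> is an equivalence relation, and \<^const>\<open>D2\<close> does not depend on the chosen
  representatives.
\<close>

lemma equiv_ae_rel:
  fixes M :: "'m measure"
  shows "equiv (L0_maps M :: ('m \<Rightarrow> 'n::metric_space) set) (ae_rel M)"
proof (rule equivI)
  show "ae_rel M \<subseteq> L0_maps M \<times> (L0_maps M :: ('m \<Rightarrow> 'n) set)"
    by (auto simp: ae_rel_def)
  show "refl_on (L0_maps M :: ('m \<Rightarrow> 'n) set) (ae_rel M)"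
    by (auto simp: refl_on_def ae_rel_def)
  show "sym (ae_rel M :: (('m \<Rightarrow> 'n) \<times> ('m \<Rightarrow> 'n)) set)"
  proof (rule symI)
    fix f g :: "'m \<Rightarrow> 'n"
    assume "(f, g) \<in> ae_rel M"
    moreover from this have "AE x in M. f x = g x"
      by (simp add: ae_rel_def)
    then have "AE x in M. g x = f x"
      by eventually_elim simp
    ultimately show "(g, f) \<in> ae_rel M"
      by (simp add: ae_rel_def)
  qed
  show "trans (ae_rel M :: (('m \<Rightarrow> 'n) \<times> ('m \<Rightarrow> 'n)) set)"
  proof (rule transI)
    fix f g k :: "'m \<Rightarrow> 'n"
    assume "(f, g) \<in> ae_rel M" "(g, k) \<in> ae_rel M"
    moreover from this have "AE x in M. f x = g x" "AE x in M. g x = k x"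
      by (simp_all add: ae_rel_def)
    then have "AE x in M. f x = k x"
      by eventually_elim simp
    ultimately show "(f, k) \<in> ae_rel M"
      by (auto simp: ae_rel_def)
  qed
qed

lemma D2_maps_cong:
  assumes "(f, f') \<in> ae_rel M" "(g, g') \<in> ae_rel M"
  shows "D2_maps M f g = D2_maps M f' g'"
proof -
  have f: "AE x in M. f x = f' x" and g: "AE x in M. g x = g' x"
    using assms by (auto simp: ae_rel_def)
  have "AE x in M. ennreal ((dist (f x) (g x))\<^sup>2) = ennreal ((dist (f' x) (g' x))\<^sup>2)"
    using f g by eventually_elim simp
  then have "(\<integral>\<^sup>+ x. ennreal ((dist (f x) (g x))\<^sup>2) \<partial>M) = (\<integral>\<^sup>+ x. ennreal ((dist (f' x) (g' x))\<^sup>2) \<partial>M)"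
    by (rule nn_integral_cong_AE)
  then show ?thesis
    by (simp add: D2_maps_def)
qed

lemma D2_class:
  assumes "f \<in> L0_maps M" "g \<in> L0_maps M"
  shows "D2 M (ae_rel M `` {f}) (ae_rel M `` {g}) = D2_maps M f g"
proof -
  let ?F = "ae_rel M `` {f}" and ?G = "ae_rel M `` {g}"
  have "(f, g) \<in> ?F \<times> ?G"
    using assms by (simp add: ae_rel_def)
  moreover have "(\<lambda>(f, g). D2_maps M f g) p = D2_maps M f g" if "p \<in> ?F \<times> ?G" for p
    using that D2_maps_cong[of f "fst p" M g "snd p"] by (simp add: case_prod_beta mem_Times_iff)
  ultimately have "(\<lambda>(f, g). D2_maps M f g) ` (?F \<times> ?G) = (\<lambda>p. D2_maps M f g) ` (?F \<times> ?G)"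
    and "?F \<times> ?G \<noteq> {}"
    by (blast intro: image_cong)+
  then show ?thesis
    unfolding D2_def by (simp only: image_constant_conv if_False the_elem_eq)
qed

end

theory Submission
  imports Defs
begin

text \<open>
  The definitions of the curvature bounds quantify over curves, and curves of maps are awkward to
  compare with curves in \<open>N\<close>. The proof therefore first removes the curves. In a complete metric
  space, being geodesic is the same as having exact midpoints (\<open>geodesic_space_iff_has_midpoints\<close>),
  and every point \<open>m\<close> with \<open>d x m = t * d x y\<close> and \<open>d m y = (1 - t) * d x y\<close> lies on a constant
  speed geodesic from \<open>x\<close> to \<open>y\<close>, because two geodesics meeting at \<open>m\<close> can be concatenated. Hence
  each of the two bounds is the conjunction of completeness, existence of midpoints, and an inequality
  between the distances of four points (\<open>global_NNC_iff\<close>, \<open>global_NPC_iff\<close>; a sign distinguishes them).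
  It remains to transfer these three properties between \<open>N\<close> and \<open>L\<^sup>2\<close>.

  From \<open>N\<close> to \<open>L\<^sup>2\<close>, completeness is the Riesz-Fischer argument. For the inequality, a point
  dividing the pair \<open>f, g\<close> of \<open>L\<^sup>2\<close> in the ratio \<open>t : 1 - t\<close> divides \<open>f x, g x\<close> in the same ratio for
  almost every \<open>x\<close>: this is the equality case of \<open>(a + b)\<^sup>2 \<le> a\<^sup>2 / t + b\<^sup>2 / (1 - t)\<close>, integrated
  (\<open>AE_intermediate_point\<close>). So the inequality of \<open>N\<close> holds pointwise and can be integrated. Midpoints
  of \<open>f\<close> and \<open>g\<close> are obtained by choosing a midpoint of \<open>f x\<close> and \<open>g x\<close> measurably in \<open>x\<close>. Midpoints
  are not unique under a lower curvature bound, and the set of pairs with a midpoint in a given open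
  set need only be analytic, so this needs a selection theorem up to null sets
  (\<open>measurable_selection_ae\<close>). It is enough to have it for finite measures: where \<open>f = g\<close> the choice is
  \<open>f\<close>, and elsewhere \<open>M\<close> has the same null sets as the finite measure with density \<open>(dist f g)\<^sup>2\<close>.

  From \<open>L\<^sup>2\<close> to \<open>N\<close>, choose a set \<open>A\<close> of finite positive measure on which \<open>h\<close> is bounded. The maps that
  are constant on \<open>A\<close> and equal to \<open>h\<close> elsewhere form a copy of \<open>N\<close> in \<open>L\<^sup>2\<close>, with distances multiplied
  by the square root of the measure of \<open>A\<close>. The inequality restricts to this copy; a limit in \<open>L\<^sup>2\<close> of a
  sequence in the copy, or a midpoint of two of its elements, takes at almost every point of \<open>A\<close> a value
  that is a limit or a midpoint in \<open>N\<close>.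
\<close>

section \<open>Lengths of absolutely continuous curves\<close>

text \<open>
  A curve is no shorter than the distance of its end points. In place of the fundamental theorem of
  calculus for absolutely continuous functions, the interval is cut along a tagged division so fine that
  a piece tagged at a point \<open>x\<close> with a metric derivative contributes at most \<open>m x + e\<close> times its length.
  The pieces tagged in the exceptional null set are small in total because of the absolute continuity of
  the curve.
\<close>

lemma metric_derivative_integral_bound:
  assumes X: "Metric_space X d" and \<gamma>: "absolutely_continuous_curve X d \<gamma>"
    and m: "AE t in lebesgue_on {0..1}. has_metric_derivative d \<gamma> (m t) t"
    and int_m: "integrable (lebesgue_on {0..1}) m"
    and ab: "0 \<le> a" "a \<le> b" "b \<le> 1"
  shows "d (\<gamma> a) (\<gamma> b) \<le> integral {a..b} m"
proof -
  interpret Metric_space X d by (rule X)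
  have inX: "\<gamma> t \<in> X" if "t \<in> {0..1}" for t
    using \<gamma> that by (auto simp: absolutely_continuous_curve_def)
  obtain g where g: "integrable (lebesgue_on {0..1}) g"
    and g_bound: "\<And>s t. 0 \<le> s \<Longrightarrow> s \<le> t \<Longrightarrow> t \<le> 1 \<Longrightarrow> d (\<gamma> s) (\<gamma> t) \<le> (LINT r|lebesgue_on {s..t}. g r)"
    using \<gamma> by (auto simp: absolutely_continuous_curve_def)
  obtain E where E: "E \<in> null_sets (lebesgue_on {0..1})"
    and E_sub: "{t \<in> {0..1}. \<not> has_metric_derivative d \<gamma> (m t) t} \<subseteq> E"
    using m by (auto simp: eventually_ae_filter)
  have neg_E: "negligible E"
    using E by (simp add: negligible_iff_null_sets null_sets_restrict_space)
  \<comment> \<open>With both densities set to 0 on \<open>E\<close>, Henstock's lemma for \<open>g'\<close> bounds the sum of the integrals of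
     \<open>g'\<close> over the pieces tagged in \<open>E\<close>, since their Riemann terms vanish.\<close>
  define m' g' where "m' = (\<lambda>t. if t \<in> E then 0 else m t)" and "g' = (\<lambda>t. if t \<in> E then 0 else g t)"
  have sub: "integrable (lebesgue_on {s..t}) f" if "integrable (lebesgue_on {0..1}) f" "0 \<le> s" "t \<le> 1"
    for f :: "real \<Rightarrow> real" and s t
    using integrable_subinterval[of 0 1 f s t] that by auto
  have int_on: "f integrable_on {s..t}" "(LINT r|lebesgue_on {s..t}. f r) = integral {s..t} f"
    if "integrable (lebesgue_on {0..1}) f" "0 \<le> s" "t \<le> 1" for f :: "real \<Rightarrow> real" and s t
    using lebesgue_integral_eq_integral[OF sub[OF that]] integrable_on_lebesgue_on[OF sub[OF that]] by auto
  have m': "m' integrable_on {s..t}" "integral {s..t} m' = integral {s..t} m"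
    if "0 \<le> s" "t \<le> 1" for s t
    using int_on[OF int_m that] integrable_spike[OF _ neg_E, of m "{s..t}" m']
      integral_spike[OF neg_E, of "{s..t}" m' m] by (auto simp: m'_def)
  have g': "g' integrable_on {s..t}" "integral {s..t} g' = integral {s..t} g"
    if "0 \<le> s" "t \<le> 1" for s t
    using int_on[OF g that] integrable_spike[OF _ neg_E, of g "{s..t}" g']
      integral_spike[OF neg_E, of "{s..t}" g' g] by (auto simp: g'_def)
  have "d (\<gamma> a) (\<gamma> b) \<le> integral {a..b} m + e * 3" if e: "e > 0" for e
  proof -
    have *: "\<exists>r>0. \<forall>s\<in>{0..1}. \<bar>s - t\<bar> < r \<longrightarrow> d (\<gamma> s) (\<gamma> t) \<le> (m t + e) * \<bar>s - t\<bar>"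
      if t: "t \<in> {0..1}" "t \<notin> E" for t
    proof -
      have "((\<lambda>s. d (\<gamma> s) (\<gamma> t) / \<bar>s - t\<bar>) \<longlongrightarrow> m t) (at t within {0..1})"
        using t E_sub by (auto simp: has_metric_derivative_def)
      then have "eventually (\<lambda>s. d (\<gamma> s) (\<gamma> t) / \<bar>s - t\<bar> < m t + e) (at t within {0..1})"
        by (rule order_tendstoD) (use e in simp)
      then obtain r where "r > 0"
        and r: "\<And>s. s \<in> {0..1} \<Longrightarrow> s \<noteq> t \<Longrightarrow> dist s t < r \<Longrightarrow> d (\<gamma> s) (\<gamma> t) / \<bar>s - t\<bar> < m t + e"
        by (auto simp: eventually_at)
      have "d (\<gamma> s) (\<gamma> t) \<le> (m t + e) * \<bar>s - t\<bar>" if "s \<in> {0..1}" "\<bar>s - t\<bar> < r" for s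
      proof (cases "s = t")
        case True then show ?thesis using inX t by auto
      next
        case False
        then show ?thesis using r[of s] that by (auto simp: dist_real_def field_simps)
      qed
      then show ?thesis using \<open>r > 0\<close> by blast
    qed
    then obtain r where r_pos: "\<And>t. t \<in> {0..1} \<Longrightarrow> t \<notin> E \<Longrightarrow> r t > 0"
      and r: "\<And>t s. t \<in> {0..1} \<Longrightarrow> t \<notin> E \<Longrightarrow> s \<in> {0..1} \<Longrightarrow> \<bar>s - t\<bar> < r t \<Longrightarrow>
          d (\<gamma> s) (\<gamma> t) \<le> (m t + e) * \<bar>s - t\<bar>"
      by metis
    define G where "G = (\<lambda>t. ball t (if t \<in> {0..1} - E then r t else 1))"
    have "gauge G"
      unfolding G_def by (rule gauge_ball_dependent) (use r_pos in auto)
    obtain Gm where Gm: "gauge Gm" "\<And>p. p tagged_partial_division_of (cbox a b) \<Longrightarrow> Gm fine p \<Longrightarrow>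
        (\<Sum>(x,k)\<in>p. norm ((measure lborel k) *\<^sub>R m' x - integral k m')) < e"
      using Henstock_lemma[of m' a b e] m'(1)[of a b] ab e by (auto simp: box_real)
    obtain Gg where Gg: "gauge Gg" "\<And>p. p tagged_partial_division_of (cbox a b) \<Longrightarrow> Gg fine p \<Longrightarrow>
        (\<Sum>(x,k)\<in>p. norm ((measure lborel k) *\<^sub>R g' x - integral k g')) < e"
      using Henstock_lemma[of g' a b e] g'(1)[of a b] ab e by (auto simp: box_real)
    obtain p where p: "p tagged_division_of cbox a b" and fine: "(\<lambda>x. G x \<inter> Gm x \<inter> Gg x) fine p"
      using fine_division_exists[OF gauge_Int[OF gauge_Int[OF \<open>gauge G\<close> Gm(1)] Gg(1)]] by blast
    have fine': "G fine p" "Gm fine p" "Gg fine p"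
      using fine by (auto simp: fine_def)
    have part: "p tagged_partial_division_of cbox a b"
      using p by (simp add: tagged_division_of_def)
    \<comment> \<open>The increments of the real function \<open>\<phi>\<close> add up exactly along the division, which replaces an
       iterated triangle inequality.\<close>
    define \<phi> where "\<phi> = (\<lambda>t. d (\<gamma> a) (\<gamma> t))"
    have summand: "\<phi> (Sup K) - \<phi> (Inf K) \<le> integral K m' + e * (Sup K - Inf K)
        + norm ((measure lborel K) *\<^sub>R m' x - integral K m') + norm ((measure lborel K) *\<^sub>R g' x - integral K g')"
      if xK: "(x, K) \<in> p" for x K
    proof -
      from p xK obtain u v where K: "K = cbox u v" "x \<in> K" "K \<subseteq> cbox a b"
        by (meson tagged_division_ofD(2) tagged_division_ofD(3) tagged_division_ofD(4))
      then have uv: "u \<le> v" "K = {u..v}" "a \<le> u" "v \<le> b" "Sup K = v" "Inf K = u" "u \<le> x" "x \<le> v"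
        by auto
      have in01: "u \<in> {0..1}" "v \<in> {0..1}" "x \<in> {0..1}" "a \<in> {0..1}"
        using uv ab by auto
      have tri: "\<phi> v - \<phi> u \<le> d (\<gamma> u) (\<gamma> v)"
        using triangle[of "\<gamma> a" "\<gamma> u" "\<gamma> v"] inX in01 by (simp add: \<phi>_def)
      have cont: "(measure lborel K) = v - u" using uv by simp
      have KG: "K \<subseteq> G x" using fine'(1) xK by (auto simp: fine_def)
      show ?thesis
      proof (cases "x \<in> E")
        case True
        then have 0: "m' x = 0" "g' x = 0" by (auto simp: m'_def g'_def)
        have "d (\<gamma> u) (\<gamma> v) \<le> integral K g'"
          using g_bound[of u v] int_on(2)[OF g, of u v] g'(2)[of u v] in01 uv by auto
        moreover have "e * (v - u) \<ge> 0" using e uv by simp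
        ultimately show ?thesis using tri 0 uv by auto
      next
        case False
        have "u \<in> K" "v \<in> K" using uv by auto
        then have "u \<in> ball x (r x)" "v \<in> ball x (r x)"
          using KG False in01 by (auto simp: G_def)
        then have "\<bar>u - x\<bar> < r x" "\<bar>v - x\<bar> < r x"
          by (auto simp: dist_real_def abs_minus_commute)
        then have "d (\<gamma> u) (\<gamma> x) \<le> (m x + e) * \<bar>u - x\<bar>" "d (\<gamma> v) (\<gamma> x) \<le> (m x + e) * \<bar>v - x\<bar>"
          using r in01 False by auto
        moreover have "d (\<gamma> u) (\<gamma> v) \<le> d (\<gamma> u) (\<gamma> x) + d (\<gamma> v) (\<gamma> x)"
          using triangle[of "\<gamma> u" "\<gamma> x" "\<gamma> v"] commute[of "\<gamma> v" "\<gamma> x"] inX in01 by simp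
        moreover have "\<bar>u - x\<bar> = x - u" "\<bar>v - x\<bar> = v - x" using uv by auto
        ultimately have "d (\<gamma> u) (\<gamma> v) \<le> (v - u) * m x + e * (v - u)"
          by (simp add: algebra_simps)
        then show ?thesis using tri uv cont False by (auto simp: m'_def)
      qed
    qed
    have fin: "finite p" using p by blast
    have "d (\<gamma> a) (\<gamma> b) = \<phi> b - \<phi> a"
      using inX ab by (simp add: \<phi>_def)
    also have "\<dots> = (\<Sum>(x,K)\<in>p. \<phi> (Sup K) - \<phi> (Inf K))"
      using additive_tagged_division_1[of a b p \<phi>] p ab by simp
    also have "\<dots> \<le> (\<Sum>(x,K)\<in>p. integral K m' + e * (Sup K - Inf K)
        + norm ((measure lborel K) *\<^sub>R m' x - integral K m') + norm ((measure lborel K) *\<^sub>R g' x - integral K g'))"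
      by (rule sum_mono) (use summand in auto)
    also have "\<dots> = (\<Sum>(x,K)\<in>p. integral K m') + e * (\<Sum>(x,K)\<in>p. Sup K - Inf K)
        + (\<Sum>(x,K)\<in>p. norm ((measure lborel K) *\<^sub>R m' x - integral K m'))
        + (\<Sum>(x,K)\<in>p. norm ((measure lborel K) *\<^sub>R g' x - integral K g'))"
      by (simp add: sum.distrib case_prod_unfold sum_distrib_left)
    also have "(\<Sum>(x,K)\<in>p. integral K m') = integral {a..b} m'"
      using integral_combine_tagged_division_topdown[of m' a b p] m'(1)[of a b] ab p by simp
    also have "(\<Sum>(x,K)\<in>p. Sup K - Inf K) = b - a"
      using additive_tagged_division_1[of a b p "\<lambda>x. x"] p ab by simp
    also have "integral {a..b} m' + e * (b - a)
        + (\<Sum>(x,K)\<in>p. norm ((measure lborel K) *\<^sub>R m' x - integral K m'))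
        + (\<Sum>(x,K)\<in>p. norm ((measure lborel K) *\<^sub>R g' x - integral K g')) \<le> integral {a..b} m' + e * 1 + e + e"
      using Gm(2)[OF part fine'(2)] Gg(2)[OF part fine'(3)] mult_left_mono[of "b - a" 1 e] e ab
      by (intro add_mono) auto
    finally show ?thesis using m'(2)[of a b] ab by simp
  qed
  then have "d (\<gamma> a) (\<gamma> b) \<le> integral {a..b} m + e" if "e > 0" for e
    using that by (metis divide_pos_pos nonzero_eq_divide_eq zero_less_numeral zero_neq_numeral)
  then show ?thesis by (rule field_le_epsilon)
qed

definition has_midpoints :: "'a set \<Rightarrow> ('a \<Rightarrow> 'a \<Rightarrow> real) \<Rightarrow> bool" where
  "has_midpoints X d \<longleftrightarrow>
     (\<forall>x\<in>X. \<forall>y\<in>X. \<exists>m\<in>X. d x m = d x y / 2 \<and> d m y = d x y / 2)"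

text \<open>
  By continuity the curve passes through a point at half the distance from its start. The part before
  this point has at least half of the length, which leaves at most half for the part after it and so
  bounds the distance of the point from the end.
\<close>

lemma geodesic_space_imp_has_midpoints:
  assumes "geodesic_space X d"
  shows "has_midpoints X d"
  unfolding has_midpoints_def
proof (intro ballI)
  fix x y assume xy: "x \<in> X" "y \<in> X"
  interpret Metric_space X d using assms by (simp add: geodesic_space_def)
  obtain \<gamma> where \<gamma>: "absolutely_continuous_curve X d \<gamma>" and ends: "\<gamma> 0 = x" "\<gamma> 1 = y"
    and len: "has_curve_length d \<gamma> (d x y)"
    using assms xy by (auto simp: geodesic_space_def)
  have inX: "\<gamma> t \<in> X" if "t \<in> {0..1}" for t
    using \<gamma> that by (auto simp: absolutely_continuous_curve_def)
  obtain g where g: "integrable (lebesgue_on {0..1}) g"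
    and g_bound: "\<And>s t. 0 \<le> s \<Longrightarrow> s \<le> t \<Longrightarrow> t \<le> 1 \<Longrightarrow> d (\<gamma> s) (\<gamma> t) \<le> (LINT r|lebesgue_on {s..t}. g r)"
    using \<gamma> by (auto simp: absolutely_continuous_curve_def)
  obtain m where m: "AE t in lebesgue_on {0..1}. has_metric_derivative d \<gamma> (m t) t"
    and int_m: "integrable (lebesgue_on {0..1}) m" and m_eq: "(LINT r|lebesgue_on {0..1}. m r) = d x y"
    using len by (auto simp: has_curve_length_def has_bochner_integral_iff)
  have g_on: "g integrable_on {0..1}" and m_on: "m integrable_on {0..1}"
    using integrable_on_lebesgue_on[OF g] integrable_on_lebesgue_on[OF int_m] by auto
  define G where "G = (\<lambda>t. integral {0..t} g)"
  have G: "d (\<gamma> s) (\<gamma> t) \<le> \<bar>G t - G s\<bar>" if "s \<in> {0..1}" "t \<in> {0..1}" "s \<le> t" for s t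
  proof -
    have "integrable (lebesgue_on {s..t}) g"
      using integrable_subinterval[of 0 1 g s t] g that by auto
    then have "d (\<gamma> s) (\<gamma> t) \<le> integral {s..t} g"
      using g_bound[of s t] that lebesgue_integral_eq_integral[of "{s..t}" g] by simp
    also have "integral {s..t} g = G t - G s"
      using Henstock_Kurzweil_Integration.integral_combine[of 0 s t g]
        integrable_subinterval_real[OF g_on, of 0 t] that by (simp add: G_def)
    finally show ?thesis by simp
  qed
  have G': "d (\<gamma> s) (\<gamma> t) \<le> \<bar>G t - G s\<bar>" if "s \<in> {0..1}" "t \<in> {0..1}" for s t
    using G[of s t] G[of t s] that commute[of "\<gamma> s" "\<gamma> t"] by (cases "s \<le> t") auto
  have contG: "continuous_on {0..1} G"
    unfolding G_def by (rule indefinite_integral_continuous_1[OF g_on])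
  have "continuous_on {0..1} (\<lambda>t. d x (\<gamma> t))"
    unfolding continuous_on_iff
  proof (intro ballI allI impI)
    fix t e :: real assume t: "t \<in> {0..1}" and "e > 0"
    then obtain r where "r > 0" and r: "\<And>s. s \<in> {0..1} \<Longrightarrow> dist s t < r \<Longrightarrow> dist (G s) (G t) < e"
      using contG unfolding continuous_on_iff by blast
    have "dist (d x (\<gamma> s)) (d x (\<gamma> t)) < e" if s: "s \<in> {0..1}" "dist s t < r" for s
    proof -
      have "\<bar>d x (\<gamma> s) - d x (\<gamma> t)\<bar> \<le> d (\<gamma> s) (\<gamma> t)"
        using triangle[of x "\<gamma> s" "\<gamma> t"] triangle[of x "\<gamma> t" "\<gamma> s"] commute[of "\<gamma> s" "\<gamma> t"]
          xy inX[of s] inX[of t] s t by linarith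
      also have "\<dots> \<le> \<bar>G t - G s\<bar>" using G' s t by simp
      also have "\<dots> < e" using r[OF s] by (simp add: dist_real_def)
      finally show ?thesis by (simp add: dist_real_def)
    qed
    then show "\<exists>r>0. \<forall>s\<in>{0..1}. dist s t < r \<longrightarrow> dist (d x (\<gamma> s)) (d x (\<gamma> t)) < e"
      using \<open>r > 0\<close> by blast
  qed
  then obtain t where t: "0 \<le> t" "t \<le> 1" "d x (\<gamma> t) = d x y / 2"
    using IVT'[of "\<lambda>t. d x (\<gamma> t)" 0 "d x y / 2" 1] ends xy by auto
  have "d x (\<gamma> t) \<le> integral {0..t} m" "d (\<gamma> t) y \<le> integral {t..1} m"
    using metric_derivative_integral_bound[OF Metric_space_axioms \<gamma> m int_m] t ends by auto
  moreover have "integral {0..t} m + integral {t..1} m = d x y"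
    using Henstock_Kurzweil_Integration.integral_combine[of 0 t 1 m] m_on t
      lebesgue_integral_eq_integral[OF int_m] m_eq by simp
  ultimately have "d (\<gamma> t) y \<le> d x y / 2" using t by simp
  moreover have "d x y \<le> d x (\<gamma> t) + d (\<gamma> t) y"
    using triangle xy inX t by simp
  ultimately show "\<exists>m\<in>X. d x m = d x y / 2 \<and> d m y = d x y / 2"
    using t inX by (intro bexI[of _ "\<gamma> t"]) auto
qed


section \<open>Geodesics from midpoints\<close>

lemma (in Metric_space) MCauchy_if_summable_steps:
  assumes "\<And>n. a n \<in> M" and step: "\<And>n. d (a n) (a (Suc n)) \<le> e n" and "summable e"
  shows "MCauchy a"
  unfolding MCauchy_def
proof (intro conjI allI impI)
  fix r :: real assume "r > 0"
  have e_nonneg: "0 \<le> e n" for n using step[of n] nonneg order_trans by blast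
  have sum: "d (a n) (a (n + k)) \<le> sum e {n..<n + k}" for n k
  proof (induction k)
    case 0 then show ?case using assms(1) by simp
  next
    case (Suc k)
    have "d (a n) (a (n + Suc k)) \<le> d (a n) (a (n + k)) + d (a (n + k)) (a (Suc (n + k)))"
      using triangle assms(1) by simp
    then show ?case using Suc step[of "n + k"] by simp
  qed
  obtain N where N: "\<And>m n. m \<ge> N \<Longrightarrow> norm (sum e {m..<n}) < r"
    using \<open>summable e\<close> \<open>r > 0\<close> unfolding summable_Cauchy by blast
  have *: "d (a n) (a n') < r" if "N \<le> n" "n \<le> n'" for n n'
    using sum[of n "n' - n"] N[of n n'] that by (simp add: abs_less_iff)
  show "\<exists>N. \<forall>n n'. N \<le> n \<longrightarrow> N \<le> n' \<longrightarrow> d (a n) (a n') < r"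
  proof (intro exI[of _ N] allI impI)
    fix n n' assume "N \<le> n" "N \<le> n'"
    then show "d (a n) (a n') < r"
      using *[of n n'] *[of n' n] commute[of "a n" "a n'"] by (cases "n \<le> n'") auto
  qed
qed (use assms(1) in auto)

text \<open>
  Repeated bisection places \<open>2 ^ n + 1\<close> points between \<open>x\<close> and \<open>y\<close>. Consecutive ones are \<open>d x y / 2 ^ n\<close> apart,
  and since these steps add up to no more than \<open>d x y\<close>, the distance between any two of the points is
  proportional to the difference of their indices. The value of the geodesic at \<open>t\<close> is the limit of the
  points with index \<open>\<lfloor>2 ^ n * t\<rfloor>\<close>; defining it at all \<open>t\<close> at once makes an extension from the dyadic
  numbers unnecessary.
\<close>

lemma (in Metric_space) constant_speed_geodesic_from_midpoints:
  assumes complete: "mcomplete" and mid: "has_midpoints M d" and xy: "x \<in> M" "y \<in> M"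
  obtains \<gamma> where "constant_speed_geodesic M d \<gamma>" "\<gamma> 0 = x" "\<gamma> 1 = y"
proof -
  obtain mp where mp: "\<And>u v. u \<in> M \<Longrightarrow> v \<in> M \<Longrightarrow> mp u v \<in> M"
      "\<And>u v. u \<in> M \<Longrightarrow> v \<in> M \<Longrightarrow> d u (mp u v) = d u v / 2"
      "\<And>u v. u \<in> M \<Longrightarrow> v \<in> M \<Longrightarrow> d (mp u v) v = d u v / 2"
    using mid unfolding has_midpoints_def by metis
  define D where "D = d x y"
  \<comment> \<open>\<open>c n k\<close> is the point with index \<open>k\<close> at level \<open>n\<close>; even indices repeat the level before.\<close>
  define c where "c = rec_nat (\<lambda>k::nat. if k = 0 then x else y)
      (\<lambda>n cn k. if even k then cn (k div 2) else mp (cn (k div 2)) (cn (Suc (k div 2))))"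
  have c0: "c 0 k = (if k = 0 then x else y)" for k by (simp add: c_def)
  have cSuc: "c (Suc n) k = (if even k then c n (k div 2) else mp (c n (k div 2)) (c n (Suc (k div 2))))" for n k
    by (simp add: c_def)
  have inM: "c n k \<in> M" for n k
    by (induction n arbitrary: k) (auto simp: c0 cSuc xy mp)
  have step: "k < 2 ^ n \<Longrightarrow> d (c n k) (c n (Suc k)) = D / 2 ^ n" for n k
  proof (induction n arbitrary: k)
    case 0 then show ?case by (simp add: c0 D_def)
  next
    case (Suc n)
    then have "k div 2 < 2 ^ n" by auto
    then have IH: "d (c n (k div 2)) (c n (Suc (k div 2))) = D / 2 ^ n" by (rule Suc.IH)
    show ?case
      by (cases "even k") (auto simp: cSuc mp inM IH)
  qed
  have c_start: "c n 0 = x" for n by (induction n) (auto simp: c0 cSuc)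
  have c_end: "c n (2 ^ n) = y" for n by (induction n) (auto simp: c0 cSuc)
  have upper: "d (c n i) (c n j) \<le> real (j - i) * (D / 2 ^ n)" if "i \<le> j" "j \<le> 2 ^ n" for n i j
    using that
  proof (induction j rule: dec_induct)
    case base then show ?case using inM by simp
  next
    case (step k)
    have "d (c n i) (c n (Suc k)) \<le> d (c n i) (c n k) + d (c n k) (c n (Suc k))"
      using triangle inM by blast
    also have "\<dots> \<le> real (k - i) * (D / 2 ^ n) + D / 2 ^ n"
      using step.IH step.prems \<open>\<And>n k. k < 2 ^ n \<Longrightarrow> d (c n k) (c n (Suc k)) = D / 2 ^ n\<close>[of k n] by simp
    also have "\<dots> = real (Suc k - i) * (D / 2 ^ n)"
      using step.hyps by (simp add: Suc_diff_le distrib_right add_divide_distrib)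
    finally show ?case .
  qed
  have exact: "d (c n i) (c n j) = real (j - i) * (D / 2 ^ n)" if ij: "i \<le> j" "j \<le> 2 ^ n" for n i j
  proof (rule antisym)
    have "D \<le> d (c n 0) (c n i) + d (c n i) (c n (2 ^ n))"
      using triangle[OF xy(1) inM xy(2), of n i] by (simp add: c_start c_end D_def)
    also have "d (c n i) (c n (2 ^ n)) \<le> d (c n i) (c n j) + d (c n j) (c n (2 ^ n))"
      using triangle inM by simp
    finally have "D \<le> real i * (D / 2 ^ n) + d (c n i) (c n j) + real (2 ^ n - j) * (D / 2 ^ n)"
      using upper[of 0 i n] upper[of j "2 ^ n" n] ij by simp
    moreover have "real i * (D / 2 ^ n) + real (j - i) * (D / 2 ^ n) + real (2 ^ n - j) * (D / 2 ^ n)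
        = real (i + (j - i) + (2 ^ n - j)) * (D / 2 ^ n)"
      by (simp only: of_nat_add distrib_right)
    moreover have "real (i + (j - i) + (2 ^ n - j)) * (D / 2 ^ n) = real (2 ^ n) * (D / 2 ^ n)"
      by (subst le_add_diff_inverse[OF ij(1)], subst le_add_diff_inverse[OF ij(2)]) (rule refl)
    moreover have "real (2 ^ n) * (D / 2 ^ n) = D" by simp
    ultimately show "real (j - i) * (D / 2 ^ n) \<le> d (c n i) (c n j)" by linarith
  qed (rule upper[OF ij])
  define fl where "fl = (\<lambda>n (t::real). nat \<lfloor>2 ^ n * t\<rfloor>)"
  define a where "a = (\<lambda>t n. c n (fl n t))"
  have fl_real: "real (fl n t) \<le> 2 ^ n * t" "2 ^ n * t < real (fl n t) + 1" if "t \<in> {0..1}" for n and t :: real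
  proof -
    have "real (fl n t) = of_int \<lfloor>2 ^ n * t\<rfloor>" using that by (simp add: fl_def)
    then show "real (fl n t) \<le> 2 ^ n * t" "2 ^ n * t < real (fl n t) + 1" by linarith+
  qed
  have fl_le: "fl n t \<le> 2 ^ n" if t: "t \<in> {0..1}" for n and t :: real
  proof -
    have "2 ^ n * t \<le> 2 ^ n" using t by (simp add: mult_left_le)
    from order_trans[OF fl_real(1)[OF t, of n] this] show ?thesis
      by (metis of_nat_le_iff of_nat_numeral of_nat_power)
  qed
  have fl_lim: "(\<lambda>n. real (fl n t) / 2 ^ n) \<longlonglongrightarrow> t" if t: "t \<in> {0..1}" for t
  proof (rule tendsto_sandwich)
    show "\<forall>\<^sub>F n in sequentially. t - (1/2) ^ n \<le> real (fl n t) / 2 ^ n"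
    proof (intro always_eventually allI)
      fix n
      have "t \<le> (real (fl n t) + 1) / 2 ^ n"
        using fl_real(2)[OF t, of n] by (simp add: pos_le_divide_eq mult.commute less_imp_le)
      then show "t - (1/2) ^ n \<le> real (fl n t) / 2 ^ n"
        by (simp add: add_divide_distrib power_one_over)
    qed
    show "\<forall>\<^sub>F n in sequentially. real (fl n t) / 2 ^ n \<le> t"
      using fl_real[OF t] by (intro always_eventually allI) (simp add: divide_simps mult.commute)
    have "(\<lambda>n. t - (1/2) ^ n) \<longlonglongrightarrow> t - 0"
      by (intro tendsto_intros LIMSEQ_power_zero) auto
    then show "(\<lambda>n. t - (1/2) ^ n) \<longlonglongrightarrow> t" by simp
  qed simp
  have fl_Suc: "fl (Suc n) t = 2 * fl n t \<or> fl (Suc n) t = Suc (2 * fl n t)" if t: "t \<in> {0..1}" for n t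
  proof -
    have "real (fl (Suc n) t) < real (2 * fl n t + 2)" "real (2 * fl n t) < real (fl (Suc n) t + 1)"
      using fl_real[OF t, of n] fl_real[OF t, of "Suc n"] by auto
    then have "fl (Suc n) t < 2 * fl n t + 2" "2 * fl n t < fl (Suc n) t + 1"
      unfolding of_nat_less_iff .
    then show ?thesis by linarith
  qed
  have a_step: "d (a t n) (a t (Suc n)) \<le> D * (1/2) ^ n" if t: "t \<in> {0..1}" for t n
  proof -
    have "a t n = c (Suc n) (2 * fl n t)" by (simp add: a_def cSuc)
    then have "d (a t n) (a t (Suc n)) = real (fl (Suc n) t - 2 * fl n t) * (D / 2 ^ Suc n)"
      using exact[of "2 * fl n t" "fl (Suc n) t" "Suc n"] fl_Suc[OF t, of n] fl_le[OF t, of "Suc n"]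
      by (auto simp: a_def)
    also have "\<dots> \<le> 1 * (D / 2 ^ Suc n)"
      using fl_Suc[OF t, of n] by (intro mult_right_mono) (auto simp: D_def)
    also have "\<dots> \<le> D * (1/2) ^ n"
      by (simp add: power_divide field_simps D_def)
    finally show ?thesis .
  qed
  have "\<exists>l. limitin mtopology (a t) l sequentially" if t: "t \<in> {0..1}" for t
  proof -
    have "MCauchy (a t)"
    proof (rule MCauchy_if_summable_steps)
      show "a t n \<in> M" for n using inM by (simp add: a_def)
      show "d (a t n) (a t (Suc n)) \<le> D * (1/2) ^ n" for n by (rule a_step[OF t])
      show "summable (\<lambda>n. D * (1/2) ^ n)" by (intro summable_mult summable_geometric) simp
    qed
    then show ?thesis using complete by (simp add: mcomplete_def)
  qed
  then obtain \<gamma> where \<gamma>: "\<And>t. t \<in> {0..1} \<Longrightarrow> limitin mtopology (a t) (\<gamma> t) sequentially" by metis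
  have \<gamma>M: "\<gamma> t \<in> M" if "t \<in> {0..1}" for t
    using \<gamma>[OF that] by (simp add: limitin_mspace)
  have \<gamma>_dist: "d (\<gamma> s) (\<gamma> t) = (t - s) * D" if st: "s \<in> {0..1}" "t \<in> {0..1}" "s \<le> t" for s t
  proof (rule LIMSEQ_unique)
    have as: "(\<lambda>n. d (a s n) (\<gamma> s)) \<longlonglongrightarrow> 0" and at: "(\<lambda>n. d (a t n) (\<gamma> t)) \<longlonglongrightarrow> 0"
      using \<gamma> st by (auto simp: limitin_metric_dist_null)
    have "\<bar>d (a s n) (a t n) - d (\<gamma> s) (\<gamma> t)\<bar> \<le> d (a s n) (\<gamma> s) + d (a t n) (\<gamma> t)" for n
    proof -
      have "a s n \<in> M" "a t n \<in> M" "\<gamma> s \<in> M" "\<gamma> t \<in> M" using inM \<gamma>M st by (auto simp: a_def)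
      then show ?thesis
        using triangle[of "a s n" "\<gamma> s" "a t n"] triangle[of "\<gamma> s" "\<gamma> t" "a t n"]
          triangle[of "\<gamma> s" "a s n" "\<gamma> t"] triangle[of "a s n" "a t n" "\<gamma> t"]
          commute[of "a s n" "\<gamma> s"] commute[of "a t n" "\<gamma> t"] by linarith
    qed
    moreover have "(\<lambda>n. d (a s n) (\<gamma> s) + d (a t n) (\<gamma> t)) \<longlonglongrightarrow> 0"
      using tendsto_add[OF as at] by simp
    ultimately have "(\<lambda>n. d (a s n) (a t n) - d (\<gamma> s) (\<gamma> t)) \<longlonglongrightarrow> 0"
      by (intro Lim_null_comparison[OF _ \<open>(\<lambda>n. d (a s n) (\<gamma> s) + d (a t n) (\<gamma> t)) \<longlonglongrightarrow> 0\<close>]) auto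
    then show "(\<lambda>n. d (a s n) (a t n)) \<longlonglongrightarrow> d (\<gamma> s) (\<gamma> t)" by (simp add: LIM_zero_iff)
    have fl_mono: "fl n s \<le> fl n t" for n
      unfolding fl_def using st by (intro nat_mono floor_mono mult_left_mono) auto
    have "d (a s n) (a t n) = (real (fl n t) / 2 ^ n - real (fl n s) / 2 ^ n) * D" for n
      using exact[of "fl n s" "fl n t" n] fl_mono[of n] fl_le[OF st(2), of n]
      by (simp add: a_def of_nat_diff field_simps)
    then show "(\<lambda>n. d (a s n) (a t n)) \<longlonglongrightarrow> (t - s) * D"
      using st by (auto intro!: tendsto_intros fl_lim)
  qed
  have "limitin mtopology (a 0) x sequentially" "limitin mtopology (a 1) y sequentially"
    using xy by (auto simp: a_def fl_def c_start c_end nat_power_eq limitin_const)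
  then have ends: "\<gamma> 0 = x" "\<gamma> 1 = y"
    using \<gamma>[of 0] \<gamma>[of 1] limitin_metric_unique by (auto intro: limitin_metric_unique)
  have "d (\<gamma> s) (\<gamma> t) = \<bar>t - s\<bar> * d (\<gamma> 0) (\<gamma> 1)" if "s \<in> {0..1}" "t \<in> {0..1}" for s t
    using \<gamma>_dist[of s t] \<gamma>_dist[of t s] commute[of "\<gamma> s" "\<gamma> t"] that ends by (cases "s \<le> t") (auto simp: D_def)
  then have "constant_speed_geodesic M d \<gamma>"
    using \<gamma>M unfolding constant_speed_geodesic_def by blast
  then show thesis using that ends by blast
qed

lemma constant_speed_geodesic_imp_length:
  assumes "Metric_space X d" "constant_speed_geodesic X d \<gamma>"
  shows "absolutely_continuous_curve X d \<gamma>" "has_curve_length d \<gamma> (d (\<gamma> 0) (\<gamma> 1))"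
proof -
  define D where "D = d (\<gamma> 0) (\<gamma> 1)"
  have X: "\<gamma> ` {0..1} \<subseteq> X"
    and \<gamma>: "\<And>s t. s \<in> {0..1} \<Longrightarrow> t \<in> {0..1} \<Longrightarrow> d (\<gamma> s) (\<gamma> t) = \<bar>t - s\<bar> * D"
    using assms(2) unfolding constant_speed_geodesic_def D_def by blast+
  have const: "has_bochner_integral (lebesgue_on {s..t}) (\<lambda>_. D) ((t - s) * D)" if "s \<le> t" for s t :: real
    using that by (auto simp: has_bochner_integral_iff measure_restrict_space)
  show "absolutely_continuous_curve X d \<gamma>"
    unfolding absolutely_continuous_curve_def
  proof (intro conjI exI[of _ "\<lambda>_. D"] allI impI X)
    show "integrable (lebesgue_on {0..1::real}) (\<lambda>_. D)"
      by (rule has_bochner_integral_iff[THEN iffD1, THEN conjunct1, OF const[OF zero_le_one]])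
    fix s t :: real assume st: "0 \<le> s \<and> s \<le> t \<and> t \<le> 1"
    then have int: "(LINT r|lebesgue_on {s..t}. D) = (t - s) * D"
      by (intro has_bochner_integral_integral_eq const) simp
    have "d (\<gamma> s) (\<gamma> t) = (t - s) * D" using \<gamma>[of s t] st by simp
    then show "d (\<gamma> s) (\<gamma> t) \<le> (LINT r|lebesgue_on {s..t}. D)"
      by (simp only: int order.refl)
  qed
  have "has_metric_derivative d \<gamma> D t" if t: "t \<in> {0..1}" for t
    unfolding has_metric_derivative_def
  proof (rule tendsto_eventually)
    have "d (\<gamma> s) (\<gamma> t) / \<bar>s - t\<bar> = D" if "s \<in> {0..1}" "s \<noteq> t" for s
      using \<gamma>[OF that(1) t] that by (simp add: abs_minus_commute)
    then show "\<forall>\<^sub>F s in at t within {0..1}. d (\<gamma> s) (\<gamma> t) / \<bar>s - t\<bar> = D"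
      by (auto simp: eventually_at intro!: exI[of _ 1])
  qed
  then have "AE t in lebesgue_on {0..1}. has_metric_derivative d \<gamma> D t"
    by (intro AE_I2) auto
  then show "has_curve_length d \<gamma> (d (\<gamma> 0) (\<gamma> 1))"
    unfolding has_curve_length_def using const[of 0 1] by (auto simp: D_def intro!: exI[of _ "\<lambda>_. D"])
qed

lemma geodesic_space_iff_has_midpoints:
  assumes "Metric_space X d" "Metric_space.mcomplete X d"
  shows "geodesic_space X d \<longleftrightarrow> has_midpoints X d"
proof
  assume mid: "has_midpoints X d"
  interpret Metric_space X d by fact
  show "geodesic_space X d"
    unfolding geodesic_space_def
  proof (intro conjI ballI assms(1))
    fix x y assume "x \<in> X" "y \<in> X"
    then obtain \<gamma> where "constant_speed_geodesic X d \<gamma>" "\<gamma> 0 = x" "\<gamma> 1 = y"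
      using constant_speed_geodesic_from_midpoints[OF assms(2) mid] by blast
    then show "\<exists>\<gamma>. absolutely_continuous_curve X d \<gamma> \<and> \<gamma> 0 = x \<and> \<gamma> 1 = y \<and> has_curve_length d \<gamma> (d x y)"
      using constant_speed_geodesic_imp_length[OF assms(1)] by blast
  qed
qed (rule geodesic_space_imp_has_midpoints)

section \<open>Curvature bounds as four-point inequalities\<close>

text \<open>
  The geodesics from \<open>x\<close> to \<open>m\<close> and from \<open>m\<close> to \<open>y\<close>, run on \<open>[0, t]\<close> and \<open>[t, 1]\<close>, have the same speed \<open>d x y\<close>.
  Their concatenation is therefore \<open>d x y\<close>-Lipschitz, and a Lipschitz curve with this constant between
  points at distance \<open>d x y\<close> must have constant speed.
\<close>

lemma (in Metric_space) constant_speed_geodesic_through: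
  assumes complete: "mcomplete" and mid: "has_midpoints M d"
    and pts: "x \<in> M" "y \<in> M" "m \<in> M" and t: "0 < t" "t < 1"
    and xm: "d x m = t * d x y" and my: "d m y = (1 - t) * d x y"
  obtains \<gamma> where "constant_speed_geodesic M d \<gamma>" "\<gamma> 0 = x" "\<gamma> 1 = y" "\<gamma> t = m"
proof -
  obtain \<alpha> where \<alpha>: "constant_speed_geodesic M d \<alpha>" "\<alpha> 0 = x" "\<alpha> 1 = m"
    using constant_speed_geodesic_from_midpoints[OF complete mid pts(1,3)] .
  obtain \<beta> where \<beta>: "constant_speed_geodesic M d \<beta>" "\<beta> 0 = m" "\<beta> 1 = y"
    using constant_speed_geodesic_from_midpoints[OF complete mid pts(3,2)] .
  define D where "D = d x y"
  define \<gamma> where "\<gamma> = (\<lambda>s. if s \<le> t then \<alpha> (s / t) else \<beta> ((s - t) / (1 - t)))"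
  have \<alpha>_dist: "d (\<alpha> u) (\<alpha> v) = \<bar>v - u\<bar> * (t * D)" if "u \<in> {0..1}" "v \<in> {0..1}" for u v
  proof -
    have "d (\<alpha> u) (\<alpha> v) = \<bar>v - u\<bar> * d (\<alpha> 0) (\<alpha> 1)"
      using \<alpha>(1) that unfolding constant_speed_geodesic_def by blast
    then show ?thesis using \<alpha>(2,3) xm by (simp add: D_def)
  qed
  have \<beta>_dist: "d (\<beta> u) (\<beta> v) = \<bar>v - u\<bar> * ((1 - t) * D)" if "u \<in> {0..1}" "v \<in> {0..1}" for u v
  proof -
    have "d (\<beta> u) (\<beta> v) = \<bar>v - u\<bar> * d (\<beta> 0) (\<beta> 1)"
      using \<beta>(1) that unfolding constant_speed_geodesic_def by blast
    then show ?thesis using \<beta>(2,3) my by (simp add: D_def)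
  qed
  have \<alpha>M: "\<alpha> u \<in> M" and \<beta>M: "\<beta> u \<in> M" if "u \<in> {0..1}" for u
    using \<alpha>(1) \<beta>(1) that unfolding constant_speed_geodesic_def by blast+
  have left: "s / t \<in> {0..1}" if "0 \<le> s" "s \<le> t" for s
    using that t by auto
  have right: "(s - t) / (1 - t) \<in> {0..1}" if "t \<le> s" "s \<le> 1" for s
    using that t by auto
  have \<gamma>M: "\<gamma> s \<in> M" if "s \<in> {0..1}" for s
    using that left[of s] right[of s] \<alpha>M \<beta>M by (auto simp: \<gamma>_def)
  have ends: "\<gamma> 0 = x" "\<gamma> 1 = y" "\<gamma> t = m"
    using t \<alpha> \<beta> by (auto simp: \<gamma>_def)
  have upper: "d (\<gamma> s) (\<gamma> r) \<le> (r - s) * D" if sr: "0 \<le> s" "s \<le> r" "r \<le> 1" for s r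
  proof -
    consider "r \<le> t" | "s \<le> t" "t < r" | "t < s" using sr by linarith
    then show ?thesis
    proof cases
      case 1
      have "d (\<gamma> s) (\<gamma> r) = \<bar>r / t - s / t\<bar> * (t * D)"
        using \<alpha>_dist[OF left[of s] left[of r]] 1 sr by (simp add: \<gamma>_def)
      also have "\<bar>r / t - s / t\<bar> = (r - s) / t"
        using sr t by (simp add: diff_divide_distrib[symmetric])
      finally show ?thesis using t by simp
    next
      case 2
      have "d (\<gamma> s) m = \<bar>1 - s / t\<bar> * (t * D)"
        using \<alpha>_dist[OF left[of s], of 1] 2 sr \<alpha> by (simp add: \<gamma>_def)
      also have "\<bar>1 - s / t\<bar> = (t - s) / t"
        using 2 t by (simp add: field_simps)
      finally have 1: "d (\<gamma> s) m = (t - s) * D" using t by simp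
      have "d m (\<gamma> r) = \<bar>(r - t) / (1 - t)\<bar> * ((1 - t) * D)"
        using \<beta>_dist[OF _ right[of r], of 0] 2 sr \<beta> by (simp add: \<gamma>_def)
      then have "d m (\<gamma> r) = (r - t) * D" using 2 t by simp
      then show ?thesis
        using triangle[of "\<gamma> s" m "\<gamma> r"] 1 \<gamma>M sr pts by (simp add: algebra_simps)
    next
      case 3
      have "d (\<gamma> s) (\<gamma> r) = \<bar>(r - t) / (1 - t) - (s - t) / (1 - t)\<bar> * ((1 - t) * D)"
        using \<beta>_dist[OF right[of s] right[of r]] 3 sr by (simp add: \<gamma>_def)
      also have "(r - t) / (1 - t) - (s - t) / (1 - t) = (r - s) / (1 - t)"
        by (simp add: diff_divide_distrib[symmetric])
      finally show ?thesis using sr t by simp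
    qed
  qed
  have exact: "d (\<gamma> s) (\<gamma> r) = (r - s) * D" if sr: "0 \<le> s" "s \<le> r" "r \<le> 1" for s r
  proof (rule antisym)
    have "D \<le> d (\<gamma> 0) (\<gamma> s) + d (\<gamma> s) (\<gamma> r) + d (\<gamma> r) (\<gamma> 1)"
      using triangle[OF pts(1) \<gamma>M[of s] pts(2)] triangle[OF \<gamma>M[of s] \<gamma>M[of r] pts(2)] sr ends
      by (simp add: D_def)
    then show "(r - s) * D \<le> d (\<gamma> s) (\<gamma> r)"
      using upper[of 0 s] upper[of r 1] sr by (simp add: algebra_simps)
  qed (rule upper[OF sr])
  have "d (\<gamma> s) (\<gamma> r) = \<bar>r - s\<bar> * d (\<gamma> 0) (\<gamma> 1)" if "s \<in> {0..1}" "r \<in> {0..1}" for s r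
    using exact[of s r] exact[of r s] commute[of "\<gamma> s" "\<gamma> r"] that ends by (cases "s \<le> r") (auto simp: D_def)
  then have "constant_speed_geodesic M d \<gamma>"
    using \<gamma>M unfolding constant_speed_geodesic_def by blast
  then show thesis using that ends by blast
qed

text \<open>
  The sign \<open>\<sigma>\<close> is \<open>1\<close> for nonnegative and \<open>-1\<close> for nonpositive curvature.
\<close>

definition four_point_comparison :: "real \<Rightarrow> 'a set \<Rightarrow> ('a \<Rightarrow> 'a \<Rightarrow> real) \<Rightarrow> bool" where
  "four_point_comparison \<sigma> X d \<longleftrightarrow>
     (\<forall>z\<in>X. \<forall>x\<in>X. \<forall>y\<in>X. \<forall>m\<in>X. \<forall>t\<in>{0<..<1}. d x m = t * d x y \<longrightarrow> d m y = (1 - t) * d x y \<longrightarrow>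
        0 \<le> \<sigma> * ((d z m)\<^sup>2 - ((1 - t) * (d z x)\<^sup>2 + t * (d z y)\<^sup>2 - (1 - t) * t * (d x y)\<^sup>2)))"

lemma four_point_comparison_iff_geodesics:
  assumes "Metric_space X d" "Metric_space.mcomplete X d" "has_midpoints X d"
  shows "four_point_comparison \<sigma> X d \<longleftrightarrow>
     (\<forall>z\<in>X. \<forall>\<gamma>. constant_speed_geodesic X d \<gamma> \<longrightarrow> (\<forall>t\<in>{0..1}. 0 \<le> \<sigma> * ((d z (\<gamma> t))\<^sup>2 -
       ((1 - t) * (d z (\<gamma> 0))\<^sup>2 + t * (d z (\<gamma> 1))\<^sup>2 - (1 - t) * t * (d (\<gamma> 0) (\<gamma> 1))\<^sup>2))))" (is "_ \<longleftrightarrow> ?R")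
proof
  interpret Metric_space X d by fact
  show "four_point_comparison \<sigma> X d" if R: ?R
    unfolding four_point_comparison_def
  proof (intro ballI impI)
    fix z x y m t
    assume A: "z \<in> X" "x \<in> X" "y \<in> X" "m \<in> X" "t \<in> {0<..<1}" "d x m = t * d x y" "d m y = (1 - t) * d x y"
    then obtain \<gamma> where "constant_speed_geodesic X d \<gamma>" "\<gamma> 0 = x" "\<gamma> 1 = y" "\<gamma> t = m"
      using constant_speed_geodesic_through[OF assms(2,3), of x y m t] by auto
    then show "0 \<le> \<sigma> * ((d z m)\<^sup>2 - ((1 - t) * (d z x)\<^sup>2 + t * (d z y)\<^sup>2 - (1 - t) * t * (d x y)\<^sup>2))"
      using R A by fastforce
  qed
  show ?R if L: "four_point_comparison \<sigma> X d"
  proof (intro ballI allI impI)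
    fix z \<gamma> and t :: real
    assume z: "z \<in> X" and \<gamma>: "constant_speed_geodesic X d \<gamma>" and t: "t \<in> {0..1}"
    have "\<gamma> 0 \<in> X" "\<gamma> 1 \<in> X" "\<gamma> t \<in> X" using \<gamma> t unfolding constant_speed_geodesic_def by auto
    moreover have "d (\<gamma> 0) (\<gamma> t) = t * d (\<gamma> 0) (\<gamma> 1)" "d (\<gamma> t) (\<gamma> 1) = (1 - t) * d (\<gamma> 0) (\<gamma> 1)"
    proof -
      have *: "d (\<gamma> u) (\<gamma> v) = \<bar>v - u\<bar> * d (\<gamma> 0) (\<gamma> 1)" if "u \<in> {0..1}" "v \<in> {0..1}" for u v
        using \<gamma> that unfolding constant_speed_geodesic_def by blast
      have "\<bar>t - 0\<bar> = t" "\<bar>1 - t\<bar> = 1 - t" using t by auto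
      then show "d (\<gamma> 0) (\<gamma> t) = t * d (\<gamma> 0) (\<gamma> 1)" "d (\<gamma> t) (\<gamma> 1) = (1 - t) * d (\<gamma> 0) (\<gamma> 1)"
        using *[of 0 t] *[of t 1] t by auto
    qed
    moreover have "t = 0 \<or> t = 1 \<or> t \<in> {0<..<1}" using t by fastforce
    ultimately show "0 \<le> \<sigma> * ((d z (\<gamma> t))\<^sup>2 -
       ((1 - t) * (d z (\<gamma> 0))\<^sup>2 + t * (d z (\<gamma> 1))\<^sup>2 - (1 - t) * t * (d (\<gamma> 0) (\<gamma> 1))\<^sup>2))"
      using L z unfolding four_point_comparison_def by (elim disjE) auto
  qed
qed

lemma global_NNC_iff:
  assumes "Metric_space X d"
  shows "global_NNC X d \<longleftrightarrow>
    Metric_space.mcomplete X d \<and> has_midpoints X d \<and> four_point_comparison 1 X d"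
  unfolding global_NNC_def
  using assms four_point_comparison_iff_geodesics[of X d 1] geodesic_space_iff_has_midpoints[of X d] by auto

lemma global_NPC_iff:
  assumes "Metric_space X d"
  shows "global_NPC X d \<longleftrightarrow>
    Metric_space.mcomplete X d \<and> has_midpoints X d \<and> four_point_comparison (-1) X d"
  unfolding global_NPC_def
  using assms four_point_comparison_iff_geodesics[of X d "-1"] geodesic_space_iff_has_midpoints[of X d] by auto

section \<open>Measurability in separable metric spaces\<close>

definition dense_sequence :: "(nat \<Rightarrow> 'n::metric_space) \<Rightarrow> bool" where
  "dense_sequence q \<longleftrightarrow> (\<forall>x. \<forall>e>0. \<exists>i. dist x (q i) < e)"

lemma dense_sequenceD: "dense_sequence q \<Longrightarrow> e > 0 \<Longrightarrow> \<exists>i. dist x (q i) < e"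
  by (simp add: dense_sequence_def)

lemma separable_dense_sequence:
  assumes "separable_space (euclidean :: 'n::metric_space topology)"
  obtains q :: "nat \<Rightarrow> 'n::metric_space" where "dense_sequence q"
proof -
  obtain Q :: "'n set" where Q: "countable Q" "closure Q = UNIV"
    using assms unfolding separable_space_def by (auto simp: closure_of_subtopology)
  then have "Q \<noteq> {}" by auto
  have "\<exists>i. dist x (from_nat_into Q i) < e" if e: "e > 0" for x and e :: real
  proof -
    have "x \<in> closure Q" using Q by simp
    then obtain y where "y \<in> Q" "dist y x < e" using e unfolding closure_approachable by blast
    then show ?thesis
      using from_nat_into_surj[OF Q(1)] by (metis dist_commute)
  qed
  then show thesis using that unfolding dense_sequence_def by blast
qed

lemma open_rational_box:
  fixes q :: "nat \<Rightarrow> 'n::metric_space"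
  assumes dense: "dense_sequence q"
    and "open S" "(a, b) \<in> S"
  obtains i j k where "a \<in> ball (q i) (1 / Suc k)" "b \<in> ball (q j) (1 / Suc k)"
    "ball (q i) (1 / Suc k) \<times> ball (q j) (1 / Suc k) \<subseteq> S"
proof -
  obtain A B where AB: "open A" "open B" "a \<in> A" "b \<in> B" "A \<times> B \<subseteq> S"
    using open_prod_elim[OF assms(2,3)] by (metis mem_Sigma_iff)
  obtain e1 where e1: "e1 > 0" "ball a e1 \<subseteq> A" using AB by (meson openE)
  obtain e2 where e2: "e2 > 0" "ball b e2 \<subseteq> B" using AB by (meson openE)
  obtain k where k: "1 / real (Suc k) < min e1 e2 / 2"
    using nat_approx_posE[of "min e1 e2 / 2"] e1 e2 by auto
  obtain i where i: "dist a (q i) < 1 / Suc k"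
    using dense_sequenceD[OF dense, of "1 / Suc k" a] by auto
  obtain j where j: "dist b (q j) < 1 / Suc k"
    using dense_sequenceD[OF dense, of "1 / Suc k" b] by auto
  have "ball (q i) (1 / Suc k) \<subseteq> ball a e1"
  proof
    fix w assume "w \<in> ball (q i) (1 / Suc k)"
    then show "w \<in> ball a e1" using i k dist_triangle[of a w "q i"] by simp
  qed
  moreover have "ball (q j) (1 / Suc k) \<subseteq> ball b e2"
  proof
    fix w assume "w \<in> ball (q j) (1 / Suc k)"
    then show "w \<in> ball b e2" using j k dist_triangle[of b w "q j"] by simp
  qed
  ultimately have "ball (q i) (1 / Suc k) \<times> ball (q j) (1 / Suc k) \<subseteq> S"
    using e1(2) e2(2) AB(5) by blast
  moreover have "a \<in> ball (q i) (1 / Suc k)" "b \<in> ball (q j) (1 / Suc k)"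
    using i j by (simp_all add: dist_commute)
  ultimately show thesis using that by blast
qed

text \<open>
  Separability makes every open set of the product a countable union of products of balls, so the Borel
  sets of the product are generated by rectangles.
\<close>

lemma borel_measurable_Pair_separable:
  fixes f g :: "'m \<Rightarrow> 'n::metric_space"
  assumes sep: "separable_space (euclidean :: 'n topology)"
    and [measurable]: "f \<in> borel_measurable M" "g \<in> borel_measurable M"
  shows "(\<lambda>x. (f x, g x)) \<in> borel_measurable M"
proof (rule borel_measurableI)
  fix S :: "('n \<times> 'n) set" assume "open S"
  obtain q :: "nat \<Rightarrow> 'n" where dense: "dense_sequence q"
    using separable_dense_sequence[OF sep] .
  let ?B = "\<lambda>(i, j, k). ball (q i) (1 / Suc k) \<times> ball (q j) (1 / Suc k)"
  have eq: "(\<lambda>x. (f x, g x)) -` S \<inter> space M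
      = (\<Union>p\<in>{p. ?B p \<subseteq> S}. (\<lambda>x. (f x, g x)) -` ?B p \<inter> space M)" (is "?L = ?R")
  proof
    show "?L \<subseteq> ?R"
    proof
      fix x assume x: "x \<in> ?L"
      then have "(f x, g x) \<in> S" by simp
      then obtain i j k where "f x \<in> ball (q i) (1 / Suc k)" "g x \<in> ball (q j) (1 / Suc k)"
          "ball (q i) (1 / Suc k) \<times> ball (q j) (1 / Suc k) \<subseteq> S"
        by (rule open_rational_box[OF dense \<open>open S\<close>])
      then show "x \<in> ?R" using x by (intro UN_I[of "(i, j, k)"]) auto
    qed
  qed auto
  have box: "(\<lambda>x. (f x, g x)) -` ?B p \<inter> space M \<in> sets M" for p
  proof -
    have "(\<lambda>x. (f x, g x)) -` (ball a r \<times> ball b r) \<inter> space M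
        = (f -` ball a r \<inter> space M) \<inter> (g -` ball b r \<inter> space M)" for a b r by auto
    then show ?thesis by (auto simp: case_prod_unfold)
  qed
  show "(\<lambda>x. (f x, g x)) -` S \<inter> space M \<in> sets M"
    unfolding eq by (intro sets.countable_UN' countableI_type image_subsetI box)
qed

lemma borel_measurable_dist_separable:
  fixes f g :: "'m \<Rightarrow> 'n::metric_space"
  assumes "separable_space (euclidean :: 'n topology)"
    and "f \<in> borel_measurable M" "g \<in> borel_measurable M"
  shows "(\<lambda>x. dist (f x) (g x)) \<in> borel_measurable M"
proof -
  have "(\<lambda>p :: 'n \<times> 'n. dist (fst p) (snd p)) \<in> borel_measurable borel"
    by (intro borel_measurable_continuous_onI continuous_intros)
  from measurable_compose[OF borel_measurable_Pair_separable[OF assms] this] show ?thesis by simp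
qed

lemma separable_subset:
  fixes S :: "'n::metric_space set"
  assumes sep: "separable_space (euclidean :: 'n topology)"
  shows "separable_space (top_of_set S)"
proof -
  obtain q :: "nat \<Rightarrow> 'n" where dense: "dense_sequence q"
    using separable_dense_sequence[OF sep] .
  define c where "c = (\<lambda>(i, k). SOME x. x \<in> S \<inter> ball (q i) (1 / Suc k))"
  define Q where "Q = c ` {(i, k). S \<inter> ball (q i) (1 / Suc k) \<noteq> {}}"
  have c: "c (i, k) \<in> S \<inter> ball (q i) (1 / Suc k)" if "S \<inter> ball (q i) (1 / Suc k) \<noteq> {}" for i k
    unfolding c_def using that by (auto intro: someI2)
  have "Q \<subseteq> S" using c by (auto simp: Q_def)
  moreover have "countable Q" by (auto simp: Q_def intro!: countable_image countable_subset[OF subset_UNIV])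
  moreover have "S \<subseteq> closure Q"
  proof
    fix x assume x: "x \<in> S"
    show "x \<in> closure Q"
      unfolding closure_approachable
    proof (intro allI impI)
      fix e :: real assume "e > 0"
      then obtain k where k: "1 / real (Suc k) < e / 2" using nat_approx_posE[of "e / 2"] by auto
      obtain i where i: "dist x (q i) < 1 / Suc k"
        using dense_sequenceD[OF dense, of "1 / Suc k" x] by auto
      then have ne: "S \<inter> ball (q i) (1 / Suc k) \<noteq> {}" using x by (auto simp: dist_commute)
      then have "dist (q i) (c (i, k)) < 1 / Suc k" using c by auto
      then have "dist (c (i, k)) x < e"
        using i k dist_triangle[of "c (i, k)" x "q i"] by (simp add: dist_commute)
      then show "\<exists>y\<in>Q. dist y x < e" using ne unfolding Q_def by blast
    qed
  qed
  ultimately show ?thesis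
    unfolding separable_space_def by (intro exI[of _ Q]) (auto simp: closure_of_subtopology Int_absorb1)
qed

text \<open>
  When \<open>N\<close> is separable, the range condition in the definition of \<open>L\<^sup>0\<close> is automatic.
\<close>

lemma L0_maps_eq_borel_measurable:
  assumes "separable_space (euclidean :: 'n::metric_space topology)"
  shows "(L0_maps M :: ('m \<Rightarrow> 'n::metric_space) set) = borel_measurable M"
  using separable_subset[OF assms] by (auto simp: L0_maps_def)

section \<open>Measurable selection up to null sets\<close>

text \<open>
  Outer measure is continuous along increasing sequences of arbitrary sets: the covers can be replaced
  by the increasing sets \<open>\<Inter>j\<ge>i. H j\<close>.
\<close>

lemma (in finite_measure) outer_measure_bound_UN:
  fixes B :: "nat \<Rightarrow> 'a set"
  assumes "incseq B" and H: "\<And>i. \<exists>H\<in>sets M. B i \<subseteq> H \<and> measure M H \<le> c"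
  shows "\<exists>H\<in>sets M. (\<Union>i. B i) \<subseteq> H \<and> measure M H \<le> c"
proof -
  obtain H where H: "\<And>i. H i \<in> sets M" "\<And>i. B i \<subseteq> H i" "\<And>i. measure M (H i) \<le> c"
    using H by metis
  define G where "G i = (\<Inter>j\<in>{i..}. H j)" for i
  have G: "range G \<subseteq> sets M" unfolding G_def using H by auto
  have "incseq G" unfolding G_def incseq_def by auto
  have "B i \<subseteq> G i" for i
    unfolding G_def using H(2) \<open>incseq B\<close>[unfolded incseq_def] by blast
  moreover have "measure M (G i) \<le> c" for i
  proof -
    have "measure M (G i) \<le> measure M (H i)"
      using H by (intro finite_measure_mono) (auto simp: G_def)
    then show ?thesis using H(3)[of i] by simp
  qed
  then have "measure M (\<Union>i. G i) \<le> c"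
    using finite_Lim_measure_incseq[OF G \<open>incseq G\<close>] by (intro LIMSEQ_le_const2) auto
  moreover have "(\<Union>i. G i) \<in> sets M" using G by blast
  ultimately show ?thesis by (intro bexI[of _ "\<Union>i. G i"]) blast+
qed

lemma compact_closure_if_totally_bounded:
  fixes S :: "'n::metric_space set"
  assumes "complete (UNIV :: 'n set)" and tb: "\<And>e. e > 0 \<Longrightarrow> \<exists>k. finite k \<and> S \<subseteq> (\<Union>x\<in>k. ball x e)"
  shows "compact (closure S)"
  unfolding compact_eq_totally_bounded
proof (intro conjI allI impI)
  show "complete (closure S)"
    using complete_closed_subset[OF closed_closure subset_UNIV assms(1)] .
  fix e :: real assume "e > 0"
  then obtain k where k: "finite k" "S \<subseteq> (\<Union>x\<in>k. ball x (e / 2))" using tb[of "e / 2"] by auto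
  moreover have "(\<Union>x\<in>k. ball x (e / 2)) \<subseteq> (\<Union>x\<in>k. cball x (e / 2))"
    by (intro UN_mono ball_subset_cball order_refl)
  ultimately have "S \<subseteq> (\<Union>x\<in>k. cball x (e / 2))" by blast
  then have "closure S \<subseteq> (\<Union>x\<in>k. cball x (e / 2))"
    using k(1) by (intro closure_minimal) auto
  also have "\<dots> \<subseteq> (\<Union>x\<in>k. ball x e)" using \<open>e > 0\<close> by (intro UN_mono) auto
  finally show "\<exists>k. finite k \<and> closure S \<subseteq> (\<Union>x\<in>k. ball x e)" using k(1) by blast
qed

lemma closed_compact_projection:
  fixes C :: "('p::metric_space \<times> 'n::metric_space) set"
  assumes "closed C" "compact K"
  shows "closed {z. \<exists>y\<in>K. (z, y) \<in> C}"
  unfolding closed_sequential_limits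
proof (intro allI impI)
  fix x l assume A: "(\<forall>n. x n \<in> {z. \<exists>y\<in>K. (z, y) \<in> C}) \<and> x \<longlonglongrightarrow> l"
  then obtain y where y: "\<And>n. y n \<in> K" "\<And>n. (x n, y n) \<in> C" by simp metis
  obtain l' r where l': "l' \<in> K" "strict_mono r" "(y \<circ> r) \<longlonglongrightarrow> l'"
    using \<open>compact K\<close> y(1) unfolding compact_def by metis
  have lim: "(\<lambda>n. ((x \<circ> r) n, (y \<circ> r) n)) \<longlonglongrightarrow> (l, l')"
    using l'(3) LIMSEQ_subseq_LIMSEQ[OF conjunct2[OF A] l'(2)] by (intro tendsto_Pair)
  have "((x \<circ> r) n, (y \<circ> r) n) \<in> C" for n using y by simp
  from closed_sequentially[OF \<open>closed C\<close> this lim] have "(l, l') \<in> C" .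
  then show "l \<in> {z. \<exists>y\<in>K. (z, y) \<in> C}" using l' by blast
qed

text \<open>
  For compact \<open>K\<close>, the points \<open>z\<close> whose fibre meets a given closed subset of \<open>K\<close> form a closed set. So the
  first ball of radius \<open>1\<close> meeting the fibre, then the first ball of radius \<open>1/2\<close> meeting the part of the
  fibre inside the first ball, and so on, depend measurably on \<open>z\<close>, and their centres converge to a point
  of the fibre.
\<close>

lemma borel_selection_compact_fibres:
  fixes C :: "('p::metric_space \<times> 'n::metric_space) set" and q :: "nat \<Rightarrow> 'n"
  assumes dense: "dense_sequence q"
    and "complete (UNIV :: 'n set)" "closed C" "compact K"
  obtains s :: "'p \<Rightarrow> 'n" where "s \<in> borel_measurable borel"
    "\<And>z y. y \<in> K \<Longrightarrow> (z, y) \<in> C \<Longrightarrow> (z, s z) \<in> C"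
proof -
  \<comment> \<open>A list \<open>L\<close> of indices codes the intersection \<open>N L\<close> of the balls chosen so far; \<open>E L\<close> is the set of
     points whose fibre meets it.\<close>
  define N where "N L = {y. \<forall>j<length L. dist (q (L ! j)) y \<le> (1/2) ^ j}" for L :: "nat list"
  define E where "E L = {z. \<exists>y\<in>K \<inter> N L. (z, y) \<in> C}" for L
  have N_Nil: "N [] = UNIV" by (simp add: N_def)
  have N_snoc: "N (L @ [i]) = N L \<inter> cball (q i) ((1/2) ^ length L)" for L i
    by (auto simp: N_def nth_append less_Suc_eq)
  have closed_N: "closed (N L)" for L
    by (induction L rule: rev_induct) (auto simp: N_Nil N_snoc)
  have E_closed: "closed (E L)" for L
    unfolding E_def using closed_N assms(3,4) by (intro closed_compact_projection compact_Int_closed) auto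
  define code where "code z = rec_nat [] (\<lambda>_ L. L @ [LEAST i. z \<in> E (L @ [i])])" for z
  have code0: "code z 0 = []" for z by (simp add: code_def)
  have codeS: "code z (Suc n) = code z n @ [LEAST i. z \<in> E (code z n @ [i])]" for z n
    by (simp add: code_def)
  have len: "length (code z n) = n" for z n by (induction n) (auto simp: code0 codeS)
  have E_ext: "\<exists>i. z \<in> E (L @ [i])" if z: "z \<in> E L" for z L
  proof -
    obtain y where y: "y \<in> K" "y \<in> N L" "(z, y) \<in> C" using z by (auto simp: E_def)
    obtain i where "dist y (q i) < (1/2) ^ length L" using dense_sequenceD[OF dense, of "(1/2) ^ length L" y] by auto
    then have "y \<in> N (L @ [i])" using y by (auto simp: N_snoc dist_commute less_imp_le)
    then show ?thesis using y by (auto simp: E_def)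
  qed
  have code_E: "z \<in> E (code z n)" if "z \<in> E []" for z n
  proof (induction n)
    case 0 then show ?case using that by (simp add: code0)
  next
    case (Suc n)
    then show ?case unfolding codeS by (rule LeastI_ex[OF E_ext])
  qed
  have meas_code: "(\<lambda>z. code z n) \<in> measurable borel (count_space UNIV)" for n
  proof (induction n)
    case 0 then show ?case by (simp add: code0)
  next
    case (Suc n)
    have "(\<lambda>z. L @ [LEAST i. z \<in> E (L @ [i])]) \<in> measurable borel (count_space UNIV)" for L
    proof -
      have "(\<lambda>z. z \<in> E (L @ [i])) \<in> measurable borel (count_space UNIV)" for i
        by (simp add: pred_def borel_closed[OF E_closed])
      then have "(\<lambda>z. LEAST i. z \<in> E (L @ [i])) \<in> measurable borel (count_space UNIV)"
        by (rule measurable_Least)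
      then show ?thesis by (rule measurable_compose) simp
    qed
    from measurable_compose_countable[OF this Suc] show ?case by (simp add: codeS)
  qed
  \<comment> \<open>Outside \<open>E []\<close> the fibre misses \<open>K\<close>; the value \<open>q 0\<close> there only makes the sequence converge
     everywhere.\<close>
  define a where "a n z = (if z \<in> E [] then q (last (code z (Suc n))) else q 0)" for n z
  have E_sets: "E [] \<in> sets borel" using E_closed by (rule borel_closed)
  have meas_a: "a n \<in> borel_measurable borel" for n
  proof -
    have "(\<lambda>z. q (last (code z (Suc n)))) \<in> borel_measurable borel"
      using meas_code[of "Suc n"] by (rule measurable_compose) simp
    then show ?thesis unfolding a_def using E_sets by (intro measurable_If_set) auto
  qed
  have near: "\<exists>y\<in>K. (z, y) \<in> C \<and> dist (a n z) y \<le> (1/2) ^ n \<and> dist (a (Suc n) z) y \<le> (1/2) ^ Suc n"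
    if z: "z \<in> E []" for z n
  proof -
    obtain y where y: "y \<in> K" "(z, y) \<in> C" "y \<in> N (code z (Suc (Suc n)))"
      using code_E[OF z, of "Suc (Suc n)"] by (auto simp: E_def)
    have "y \<in> N (code z (Suc n))" using y(3) by (subst (asm) codeS) (simp add: N_snoc)
    then have "dist (a n z) y \<le> (1/2) ^ n" using z by (simp add: a_def codeS N_snoc len)
    moreover have "dist (a (Suc n) z) y \<le> (1/2) ^ Suc n"
      using y(3) z by (simp add: a_def codeS[of z "Suc n"] N_snoc len)
    ultimately show ?thesis using y by blast
  qed
  have conv: "\<exists>l. (\<lambda>n. a n z) \<longlonglongrightarrow> l" if z: "z \<in> E []" for z
  proof -
    obtain y where y: "\<And>n. y n \<in> K" "\<And>n. (z, y n) \<in> C" "\<And>n. dist (a n z) (y n) \<le> (1/2) ^ n"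
      "\<And>n. dist (a (Suc n) z) (y n) \<le> (1/2) ^ Suc n"
      using near[OF z] by metis
    have "dist (a n z) (a (Suc n) z) \<le> 2 * (1/2) ^ n" for n
    proof -
      have "dist (a n z) (a (Suc n) z) \<le> (1/2) ^ n + (1/2) ^ Suc n"
        using dist_triangle2[of "a n z" "a (Suc n) z" "y n"] y(3)[of n] y(4)[of n] by linarith
      moreover have "(1/2) ^ Suc n \<le> (1/2 :: real) ^ n" by simp
      ultimately show ?thesis by linarith
    qed
    have "Metric_space.MCauchy UNIV dist (\<lambda>n. a n z)"
    proof (rule Metric_space.MCauchy_if_summable_steps[OF Met_TC.Metric_space_axioms])
      show "dist (a n z) (a (Suc n) z) \<le> 2 * (1/2) ^ n" for n by fact
      show "summable (\<lambda>n. 2 * (1/2) ^ n :: real)" by (intro summable_mult summable_geometric) simp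
    qed simp
    then have "Cauchy (\<lambda>n. a n z)" by simp
    then show ?thesis using assms(2) unfolding complete_def by auto
  qed
  define s where "s z = lim (\<lambda>n. a n z)" for z
  have s: "(\<lambda>n. a n z) \<longlonglongrightarrow> s z" for z
  proof (cases "z \<in> E []")
    case True
    then show ?thesis using conv unfolding s_def by (metis limI)
  next
    case False
    then show ?thesis by (simp add: s_def a_def limI)
  qed
  have "s \<in> borel_measurable borel"
    using borel_measurable_LIMSEQ_metric[of a borel s] meas_a s by blast
  moreover have "(z, s z) \<in> C" if "y \<in> K" "(z, y) \<in> C" for z y
  proof -
    have z: "z \<in> E []" using that by (auto simp: E_def N_Nil)
    obtain y where y: "\<And>n. (z, y n) \<in> C" "\<And>n. dist (a n z) (y n) \<le> (1/2) ^ n"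
      using near[OF z] by metis
    have "(\<lambda>n. (1/2) ^ n :: real) \<longlonglongrightarrow> 0" by (intro LIMSEQ_power_zero) auto
    then have "(\<lambda>n. dist (a n z) (y n)) \<longlonglongrightarrow> 0"
      by (rule Lim_null_comparison[rotated]) (use y(2) in auto)
    then have "(\<lambda>n. dist (a n z) (y n) + dist (a n z) (s z)) \<longlonglongrightarrow> 0"
      using s[of z] unfolding tendsto_dist_iff[of "\<lambda>n. a n z"] by (rule tendsto_add_zero)
    then have "(\<lambda>n. dist (y n) (s z)) \<longlonglongrightarrow> 0"
      by (rule Lim_null_comparison[rotated]) (auto intro!: always_eventually dist_triangle3)
    then have "y \<longlonglongrightarrow> s z" by (rule tendsto_dist_iff[THEN iffD2])
    then have "(\<lambda>n. (z, y n)) \<longlonglongrightarrow> (z, s z)" by (intro tendsto_intros)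
    then show ?thesis by (rule closed_sequentially[OF \<open>closed C\<close> y(1)])
  qed
  ultimately show thesis using that by blast
qed

text \<open>
  This is the proof that analytic sets are measured from inside by compact sets. At step \<open>n\<close> the second
  coordinate is confined to finitely many balls of radius \<open>(1/2) ^ n\<close>, as many as are needed for the
  projection to keep outer measure larger than \<open>c\<close>. The intersection \<open>K\<close> of these restrictions is totally
  bounded and closed, hence compact. A point in the closures of all the projections is a limit of
  points with fibre elements in smaller and smaller restrictions; these elements accumulate in \<open>K\<close>, and
  as \<open>C\<close> is closed the limit point has a fibre element there. The closures are measurable, so their
  intersection still has measure at least \<open>c\<close>.
\<close>

lemma inner_compact_fibres:
  fixes C :: "('p::metric_space \<times> 'n::metric_space) set" and q :: "nat \<Rightarrow> 'n" and c :: real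
  assumes dense: "dense_sequence q"
    and complete: "complete (UNIV :: 'n set)" and C: "closed C" "\<And>z. \<exists>y. (z, y) \<in> C"
    and P: "finite_measure P" "sets P = sets borel" and c: "c < measure P (space P)"
  obtains K where "compact K" "c \<le> measure P {z. \<exists>y\<in>K. (z, y) \<in> C}"
proof -
  interpret finite_measure P by (rule P)
  have space_P: "space P = UNIV" using sets_eq_imp_space_eq[OF P(2)] by simp
  define pr where "pr V = {z. \<exists>y\<in>V. (z, y) \<in> C}" for V
  \<comment> \<open>\<open>thick V\<close> says that the projection of \<open>C \<inter> (UNIV \<times> V)\<close> has outer measure greater than \<open>c\<close>.\<close>
  define thick where "thick V \<longleftrightarrow> \<not> (\<exists>H\<in>sets P. pr V \<subseteq> H \<and> measure P H \<le> c)" for V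
  define W where "W n k = (\<Union>i\<le>k. cball (q i) ((1/2) ^ n))" for n k :: nat
  have "\<exists>V. \<forall>n. (thick (V n) \<and> closed (V n)) \<and> (\<exists>k. V (Suc n) = V n \<inter> W n k)"
  proof (rule dependent_nat_choice)
    have "thick UNIV" unfolding thick_def
    proof
      assume "\<exists>H\<in>sets P. pr UNIV \<subseteq> H \<and> measure P H \<le> c"
      moreover have "pr UNIV = space P" using C(2) by (auto simp: pr_def space_P)
      ultimately show False using c space_P by (auto simp: top.extremum_unique)
    qed
    then show "\<exists>V. thick V \<and> closed V" by (intro exI[of _ UNIV]) auto
  next
    fix V and n :: nat assume V: "thick V \<and> closed V"
    have "\<exists>k. thick (V \<inter> W n k)"
    proof (rule ccontr)
      assume "\<not> (\<exists>k. thick (V \<inter> W n k))"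
      then have *: "\<And>k. \<exists>H\<in>sets P. pr (V \<inter> W n k) \<subseteq> H \<and> measure P H \<le> c"
        by (simp add: thick_def)
      have "incseq (\<lambda>k. pr (V \<inter> W n k))"
        unfolding incseq_def pr_def W_def by fastforce
      from outer_measure_bound_UN[OF this *] obtain H
        where H: "H \<in> sets P" "(\<Union>k. pr (V \<inter> W n k)) \<subseteq> H" "measure P H \<le> c" by auto
      have "pr V \<subseteq> (\<Union>k. pr (V \<inter> W n k))"
      proof
        fix z assume "z \<in> pr V"
        then obtain y where y: "y \<in> V" "(z, y) \<in> C" by (auto simp: pr_def)
        obtain i where "dist y (q i) < (1/2) ^ n" using dense_sequenceD[OF dense, of "(1/2) ^ n" y] by auto
        then have "y \<in> W n i" unfolding W_def by (intro UN_I[of i]) (auto simp: dist_commute)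
        then show "z \<in> (\<Union>k. pr (V \<inter> W n k))" using y by (auto simp: pr_def)
      qed
      then show False using V H by (auto simp: thick_def)
    qed
    then obtain k where "thick (V \<inter> W n k)" ..
    moreover have "closed (W n k)" unfolding W_def by auto
    ultimately show "\<exists>V'. (thick V' \<and> closed V') \<and> (\<exists>k. V' = V \<inter> W n k)" using V by blast
  qed
  then obtain V where V: "\<And>n. thick (V n)" "\<And>n. closed (V n)"
    and V_Suc: "\<And>n. \<exists>k. V (Suc n) = V n \<inter> W n k" by metis
  have "V (Suc n) \<subseteq> V n" for n using V_Suc[of n] by auto
  then have V_dec: "V n \<subseteq> V m" if "m \<le> n" for m n using that by (rule lift_Suc_antimono_le)
  have V_cover: "\<exists>k. finite k \<and> V (Suc n) \<subseteq> (\<Union>x\<in>k. ball x e)" if e: "(1/2) ^ n < e" for n e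
  proof -
    obtain k where "V (Suc n) \<subseteq> W n k" using V_Suc[of n] by auto
    also have "W n k \<subseteq> (\<Union>x\<in>q ` {..k}. ball x e)"
    proof
      fix y assume "y \<in> W n k"
      then obtain i where "i \<le> k" "dist (q i) y \<le> (1/2) ^ n" by (auto simp: W_def)
      then show "y \<in> (\<Union>x\<in>q ` {..k}. ball x e)" using e by (intro UN_I[of "q i"]) auto
    qed
    finally show ?thesis by blast
  qed
  have small: "\<exists>n. (1/2) ^ n < e" if "e > 0" for e :: real
    using real_arch_pow_inv[OF that, of "1/2"] by auto
  define K where "K = (\<Inter>n. V n)"
  have "closed K" unfolding K_def using V(2) by auto
  have "compact (closure K)"
  proof (rule compact_closure_if_totally_bounded[OF complete])
    fix e :: real assume "e > 0"
    then obtain n where "(1/2) ^ n < e" using small by blast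
    from V_cover[OF this] show "\<exists>k. finite k \<and> K \<subseteq> (\<Union>x\<in>k. ball x e)" unfolding K_def by blast
  qed
  then have K: "compact K" using \<open>closed K\<close> by simp
  have limit: "z \<in> pr K" if z: "\<And>n. z \<in> closure (pr (V n))" for z
  proof -
    have "\<exists>z' y. y \<in> V n \<and> (z', y) \<in> C \<and> dist z' z < (1/2) ^ n" for n
    proof -
      have "(0 :: real) < (1/2) ^ n" by simp
      then obtain z' where "z' \<in> pr (V n)" "dist z' z < (1/2) ^ n"
        using z[of n] unfolding closure_approachable by blast
      then show ?thesis unfolding pr_def by blast
    qed
    then obtain z' y where zy: "\<And>n. y n \<in> V n" "\<And>n. (z' n, y n) \<in> C" "\<And>n. dist (z' n) z < (1/2) ^ n"
      by metis
    have "compact (closure (range y))"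
    proof (rule compact_closure_if_totally_bounded[OF complete])
      fix e :: real assume e: "e > 0"
      then obtain n where "(1/2) ^ n < e" using small by blast
      from V_cover[OF this] obtain k where k: "finite k" "V (Suc n) \<subseteq> (\<Union>x\<in>k. ball x e)" by blast
      have "y m \<in> (\<Union>x\<in>k \<union> y ` {..n}. ball x e)" for m
      proof (cases "m \<le> n")
        case True then show ?thesis using e by force
      next
        case False
        then have "y m \<in> V (Suc n)" using zy(1)[of m] V_dec[of "Suc n" m] by auto
        then show ?thesis using k by blast
      qed
      then show "\<exists>k. finite k \<and> range y \<subseteq> (\<Union>x\<in>k. ball x e)"
        using k(1) by (intro exI[of _ "k \<union> y ` {..n}"]) blast
    qed
    moreover have "\<forall>n. y n \<in> closure (range y)" using closure_subset[of "range y"] by auto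
    ultimately obtain l r where l: "strict_mono r" "(y \<circ> r) \<longlonglongrightarrow> l"
      unfolding compact_def by blast
    have "l \<in> V n" for n
    proof (rule closed_sequentially[OF V(2)])
      show "(\<lambda>i. (y \<circ> r) (i + n)) \<longlonglongrightarrow> l" using l(2) by (rule LIMSEQ_ignore_initial_segment)
      show "(y \<circ> r) (i + n) \<in> V n" for i
        using zy(1)[of "r (i + n)"] V_dec[of n "r (i + n)"] seq_suble[OF l(1), of "i + n"] by auto
    qed
    moreover have "(z, l) \<in> C"
    proof (rule closed_sequentially[OF C(1)])
      have "(\<lambda>n. dist (z' n) z) \<longlonglongrightarrow> 0"
        by (rule Lim_null_comparison[OF _ LIMSEQ_power_zero[of "1/2"]]) (use zy(3) in \<open>auto simp: less_imp_le\<close>)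
      then have "z' \<longlonglongrightarrow> z" by (rule tendsto_dist_iff[THEN iffD2])
      then show "(\<lambda>n. ((z' \<circ> r) n, (y \<circ> r) n)) \<longlonglongrightarrow> (z, l)"
        by (intro tendsto_Pair l(2) LIMSEQ_subseq_LIMSEQ[OF _ l(1)])
      show "((z' \<circ> r) n, (y \<circ> r) n) \<in> C" for n using zy(2) by simp
    qed
    ultimately show ?thesis by (auto simp: pr_def K_def)
  qed
  have "c \<le> measure P (\<Inter>n. closure (pr (V n)))"
  proof (rule LIMSEQ_le_const)
    show "(\<lambda>n. measure P (closure (pr (V n)))) \<longlonglongrightarrow> measure P (\<Inter>n. closure (pr (V n)))"
    proof (rule finite_Lim_measure_decseq)
      show "range (\<lambda>n. closure (pr (V n))) \<subseteq> sets P" by (auto simp: P(2))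
      show "decseq (\<lambda>n. closure (pr (V n)))"
        unfolding decseq_def using V_dec by (intro allI impI closure_mono) (auto simp: pr_def)
    qed
    have "c < measure P (closure (pr (V n)))" for n
    proof -
      have "closure (pr (V n)) \<in> sets P" by (simp add: P(2))
      then show ?thesis
        using V(1)[of n] closure_subset[of "pr (V n)"] unfolding thick_def not_le[symmetric] by blast
    qed
    then show "\<exists>N. \<forall>n\<ge>N. c \<le> measure P (closure (pr (V n)))" by (auto intro: less_imp_le)
  qed
  also have "\<dots> \<le> measure P (pr K)"
    using limit closed_compact_projection[OF C(1) K] by (intro finite_measure_mono) (auto simp: P(2) pr_def)
  finally show thesis using that K by (simp add: pr_def)
qed

text \<open>
  A selection with values in a compact set exists off a set of measure \<open>1 / (n + 1)\<close>, for each \<open>n\<close>. The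
  first of these selections that is valid at \<open>z\<close> is used at \<open>z\<close>.
\<close>

lemma measurable_selection_ae:
  fixes C :: "('p::metric_space \<times> 'n::metric_space) set"
  assumes sep: "separable_space (euclidean :: 'n topology)" and complete: "complete (UNIV :: 'n set)"
    and C: "closed C" "\<And>z. \<exists>y. (z, y) \<in> C"
    and P: "finite_measure P" "sets P = sets borel"
  obtains s where "s \<in> borel_measurable borel" "AE z in P. (z, s z) \<in> C"
proof -
  interpret finite_measure P by (rule P)
  have space_P: "space P = UNIV" using sets_eq_imp_space_eq[OF P(2)] by simp
  obtain q :: "nat \<Rightarrow> 'n" where dense: "dense_sequence q"
    using separable_dense_sequence[OF sep] .
  have "\<exists>K. compact K \<and> measure P (space P) - 1 / Suc n \<le> measure P {z. \<exists>y\<in>K. (z, y) \<in> C}" for n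
    by (rule inner_compact_fibres[OF dense complete C P, of "measure P (space P) - 1 / Suc n"]) auto
  then have "\<exists>K. \<forall>n. compact (K n) \<and>
      measure P (space P) - 1 / Suc n \<le> measure P {z. \<exists>y\<in>K n. (z, y) \<in> C}"
    by (intro choice allI)
  then obtain K where K: "\<And>n. compact (K n)"
      "\<And>n. measure P (space P) - 1 / Suc n \<le> measure P {z. \<exists>y\<in>K n. (z, y) \<in> C}"
    by blast
  have "\<exists>s. s \<in> borel_measurable borel \<and> (\<forall>z y. y \<in> K n \<longrightarrow> (z, y) \<in> C \<longrightarrow> (z, s z) \<in> C)" for n
    by (rule borel_selection_compact_fibres[OF dense complete C(1) K(1)[of n]]) blast
  then have "\<exists>s. \<forall>n. s n \<in> borel_measurable borel \<and> (\<forall>z y. y \<in> K n \<longrightarrow> (z, y) \<in> C \<longrightarrow> (z, s n z) \<in> C)"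
    by (intro choice allI)
  then obtain s where s: "\<And>n. s n \<in> borel_measurable borel"
      "\<And>n z y. y \<in> K n \<Longrightarrow> (z, y) \<in> C \<Longrightarrow> (z, s n z) \<in> C"
    by blast
  define Z where "Z n = {z. \<exists>y\<in>K n. (z, y) \<in> C}" for n
  have Z_sets: "Z n \<in> sets borel" for n
    unfolding Z_def by (intro borel_closed closed_compact_projection C(1) K(1))
  define k where "k z = (LEAST n. z \<in> Z n)" for z
  have "k \<in> measurable borel (count_space UNIV)"
    unfolding k_def by (rule measurable_Least) (simp add: pred_def Z_sets)
  from measurable_compose_countable[OF s(1) this]
  have "(\<lambda>z. s (k z) z) \<in> borel_measurable borel" .
  moreover have "AE z in P. (z, s (k z) z) \<in> C"
  proof (rule AE_I)
    show "{z \<in> space P. (z, s (k z) z) \<notin> C} \<subseteq> space P - (\<Union>n. Z n)"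
    proof (intro subsetI DiffI)
      fix z assume z: "z \<in> {z \<in> space P. (z, s (k z) z) \<notin> C}"
      show "z \<notin> (\<Union>n. Z n)"
      proof
        assume "z \<in> (\<Union>n. Z n)"
        then have "\<exists>n. z \<in> Z n" by blast
        then have "z \<in> Z (k z)" unfolding k_def by (rule LeastI_ex)
        then show False using z s(2) by (auto simp: Z_def)
      qed
    qed simp
    have Zs: "(\<Union>n. Z n) \<in> sets P" using Z_sets P(2) by auto
    then show "space P - (\<Union>n. Z n) \<in> sets P" by auto
    have "measure P (space P - (\<Union>n. Z n)) \<le> 0"
    proof (rule field_le_epsilon)
      fix e :: real assume "e > 0"
      then obtain n where n: "1 / real (Suc n) < e" using nat_approx_posE by blast
      have "measure P (Z n) \<le> measure P (\<Union>n. Z n)" using Zs by (intro finite_measure_mono) auto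
      then show "measure P (space P - (\<Union>n. Z n)) \<le> 0 + e"
        using finite_measure_compl[OF Zs] K(2)[of n] n by (simp add: Z_def)
    qed
    then show "emeasure P (space P - (\<Union>n. Z n)) = 0"
      by (simp add: emeasure_eq_measure measure_le_0_iff)
  qed
  ultimately show thesis using that by blast
qed

section \<open>The metric of square-integrable maps\<close>

text \<open>
  The defect on the right vanishes exactly when \<open>a\<close> and \<open>b\<close> are in the ratio \<open>t : 1 - t\<close>. The inequality
  gives the triangle inequality of \<open>L\<^sup>2\<close>, and its equality case describes the intermediate points.
\<close>

lemma weighted_square_defect:
  fixes a b t :: real
  assumes "0 < t" "t < 1"
  shows "a\<^sup>2 / t + b\<^sup>2 / (1 - t) - (a + b)\<^sup>2 = ((1 - t) * a - t * b)\<^sup>2 / (t * (1 - t))"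
proof -
  have "t \<noteq> 0" "1 - t \<noteq> 0" using assms by auto
  then show ?thesis by (simp add: divide_simps) algebra
qed

lemma square_add_le_weighted:
  fixes a b t :: real
  assumes "0 < t" "t < 1"
  shows "(a + b)\<^sup>2 \<le> a\<^sup>2 / t + b\<^sup>2 / (1 - t)"
proof -
  have "0 \<le> ((1 - t) * a - t * b)\<^sup>2 / (t * (1 - t))" using assms by simp
  then show ?thesis using weighted_square_defect[OF assms, of a b] by linarith
qed

text \<open>
  For each \<open>t\<close> the weighted inequality bounds the integral of \<open>w\<^sup>2\<close>. The best weight is the share of the
  norm of \<open>u\<close> in the sum of both norms; a small summand added to both norms keeps it inside \<open>(0, 1)\<close>.
\<close>

lemma L2_minkowski:
  fixes u v w :: "'m \<Rightarrow> real"
  assumes u: "integrable M (\<lambda>x. (u x)\<^sup>2)" and v: "integrable M (\<lambda>x. (v x)\<^sup>2)"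
    and w: "w \<in> borel_measurable M" "\<And>x. x \<in> space M \<Longrightarrow> 0 \<le> w x" "\<And>x. x \<in> space M \<Longrightarrow> w x \<le> u x + v x"
  shows "integrable M (\<lambda>x. (w x)\<^sup>2)"
    and "sqrt (\<integral>x. (w x)\<^sup>2 \<partial>M) \<le> sqrt (\<integral>x. (u x)\<^sup>2 \<partial>M) + sqrt (\<integral>x. (v x)\<^sup>2 \<partial>M)"
proof -
  have bound: "(w x)\<^sup>2 \<le> (u x)\<^sup>2 / t + (v x)\<^sup>2 / (1 - t)" if "0 < t" "t < 1" "x \<in> space M" for t x
  proof -
    have "(w x)\<^sup>2 \<le> (u x + v x)\<^sup>2" using w(2,3) that by (intro power_mono) auto
    then show ?thesis using square_add_le_weighted[OF that(1,2), of "u x" "v x"] by linarith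
  qed
  have int: "integrable M (\<lambda>x. (u x)\<^sup>2 / t + (v x)\<^sup>2 / (1 - t))" for t :: real using u v by simp
  show int_w: "integrable M (\<lambda>x. (w x)\<^sup>2)"
  proof (rule Bochner_Integration.integrable_bound[OF int[of "1/2"]])
    show "(\<lambda>x. (w x)\<^sup>2) \<in> borel_measurable M" using w(1) by measurable
    show "AE x in M. norm ((w x)\<^sup>2) \<le> norm ((u x)\<^sup>2 / (1/2) + (v x)\<^sup>2 / (1 - 1/2))"
      using bound[of "1/2"] by (intro AE_I2) auto
  qed
  show "sqrt (\<integral>x. (w x)\<^sup>2 \<partial>M) \<le> sqrt (\<integral>x. (u x)\<^sup>2 \<partial>M) + sqrt (\<integral>x. (v x)\<^sup>2 \<partial>M)"
  proof (rule field_le_epsilon)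
    fix e :: real assume e: "e > 0"
    define A B where "A = sqrt (\<integral>x. (u x)\<^sup>2 \<partial>M) + e / 2" and "B = sqrt (\<integral>x. (v x)\<^sup>2 \<partial>M) + e / 2"
    have AB: "A > 0" "B > 0" using e by (auto simp: A_def B_def add_nonneg_pos)
    define t where "t = A / (A + B)"
    have t: "0 < t" "t < 1" "1 - t = B / (A + B)" using AB by (auto simp: t_def field_simps)
    have A2: "(\<integral>x. (u x)\<^sup>2 \<partial>M) \<le> A\<^sup>2" and B2: "(\<integral>x. (v x)\<^sup>2 \<partial>M) \<le> B\<^sup>2"
      using e by (auto intro!: sqrt_le_D simp: A_def B_def)
    have "(\<integral>x. (w x)\<^sup>2 \<partial>M) \<le> (\<integral>x. (u x)\<^sup>2 / t + (v x)\<^sup>2 / (1 - t) \<partial>M)"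
      using bound[OF t(1,2)] by (intro integral_mono int_w int) auto
    also have "\<dots> = (\<integral>x. (u x)\<^sup>2 \<partial>M) / t + (\<integral>x. (v x)\<^sup>2 \<partial>M) / (1 - t)"
      using u v by simp
    also have "\<dots> \<le> A\<^sup>2 / t + B\<^sup>2 / (1 - t)"
      using A2 B2 t(1,2) by (intro add_mono divide_right_mono) auto
    also have "A\<^sup>2 / t = A * (A + B)" using AB by (simp add: t_def power2_eq_square)
    also have "B\<^sup>2 / (1 - t) = B * (A + B)" using AB by (simp add: t(3) power2_eq_square)
    also have "A * (A + B) + B * (A + B) = (A + B)\<^sup>2" by (simp add: power2_eq_square algebra_simps)
    finally have "sqrt (\<integral>x. (w x)\<^sup>2 \<partial>M) \<le> A + B"
      using AB by (intro real_le_lsqrt) auto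
    then show "sqrt (\<integral>x. (w x)\<^sup>2 \<partial>M) \<le> sqrt (\<integral>x. (u x)\<^sup>2 \<partial>M) + sqrt (\<integral>x. (v x)\<^sup>2 \<partial>M) + e"
      by (simp add: A_def B_def)
  qed
qed

text \<open>
  Representatives of the elements of \<open>L2\<close>. All estimates are made for maps and passed to classes by
  \<open>L2_eq_classes\<close> and \<open>L2_dist_classes\<close>.
\<close>

definition L2_maps :: "'m measure \<Rightarrow> ('m \<Rightarrow> 'n::metric_space) \<Rightarrow> ('m \<Rightarrow> 'n) set" where
  "L2_maps M h = {f \<in> borel_measurable M. integrable M (\<lambda>x. (dist (f x) (h x))\<^sup>2)}"

definition L2_dist_maps :: "'m measure \<Rightarrow> ('m \<Rightarrow> 'n::metric_space) \<Rightarrow> ('m \<Rightarrow> 'n) \<Rightarrow> real" where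
  "L2_dist_maps M f g = sqrt (\<integral>x. (dist (f x) (g x))\<^sup>2 \<partial>M)"

lemma L2_dist_maps_nonneg: "0 \<le> L2_dist_maps M f g"
  by (simp add: L2_dist_maps_def)

lemma L2_dist_maps_sq: "(L2_dist_maps M f g)\<^sup>2 = (\<integral>x. (dist (f x) (g x))\<^sup>2 \<partial>M)"
  by (simp add: L2_dist_maps_def)

context
  fixes M :: "'m measure" and h :: "'m \<Rightarrow> 'n::metric_space"
  assumes sep: "separable_space (euclidean :: 'n topology)" and h: "h \<in> borel_measurable M"
begin

lemmas borel_measurable_dist' = borel_measurable_dist_separable[OF sep]

lemma L2_maps_measurable: "f \<in> L2_maps M h \<Longrightarrow> f \<in> borel_measurable M"
  by (simp add: L2_maps_def)

lemma integrable_dist_sq: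
  assumes "f \<in> L2_maps M h" "g \<in> L2_maps M h"
  shows "integrable M (\<lambda>x. (dist (f x) (g x))\<^sup>2)"
proof (rule L2_minkowski(1))
  show "integrable M (\<lambda>x. (dist (f x) (h x))\<^sup>2)" "integrable M (\<lambda>x. (dist (g x) (h x))\<^sup>2)"
    using assms by (simp_all add: L2_maps_def)
  show "(\<lambda>x. dist (f x) (g x)) \<in> borel_measurable M"
    using assms by (intro borel_measurable_dist' L2_maps_measurable)
qed (auto intro: dist_triangle2)

lemma L2_mapsI:
  assumes f: "f \<in> L2_maps M h" and g: "g \<in> borel_measurable M" "integrable M (\<lambda>x. (dist (f x) (g x))\<^sup>2)"
  shows "g \<in> L2_maps M h"
proof -
  have "integrable M (\<lambda>x. (dist (g x) (h x))\<^sup>2)"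
  proof (rule L2_minkowski(1))
    show "integrable M (\<lambda>x. (dist (f x) (g x))\<^sup>2)" by (rule g)
    show "integrable M (\<lambda>x. (dist (f x) (h x))\<^sup>2)" using f by (simp add: L2_maps_def)
    show "(\<lambda>x. dist (g x) (h x)) \<in> borel_measurable M" by (intro borel_measurable_dist' g(1) h)
  qed (auto intro: dist_triangle3)
  then show ?thesis using g by (simp add: L2_maps_def)
qed

lemma L2_dist_maps_triangle:
  assumes "f \<in> L2_maps M h" "g \<in> L2_maps M h" "k \<in> L2_maps M h"
  shows "L2_dist_maps M f k \<le> L2_dist_maps M f g + L2_dist_maps M g k"
  unfolding L2_dist_maps_def
proof (rule L2_minkowski(2))
  show "integrable M (\<lambda>x. (dist (f x) (g x))\<^sup>2)" "integrable M (\<lambda>x. (dist (g x) (k x))\<^sup>2)"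
    using assms by (simp_all add: integrable_dist_sq)
  show "(\<lambda>x. dist (f x) (k x)) \<in> borel_measurable M"
    using assms by (intro borel_measurable_dist' L2_maps_measurable)
qed (auto intro: dist_triangle)

lemma L2_dist_maps_eq_0_iff:
  assumes "f \<in> L2_maps M h" "g \<in> L2_maps M h"
  shows "L2_dist_maps M f g = 0 \<longleftrightarrow> (AE x in M. f x = g x)"
  unfolding L2_dist_maps_def
  using integral_nonneg_eq_0_iff_AE[OF integrable_dist_sq[OF assms]] by simp

lemma nn_integral_dist_sq:
  assumes "f \<in> L2_maps M h" "g \<in> L2_maps M h"
  shows "(\<integral>\<^sup>+x. ennreal ((dist (f x) (g x))\<^sup>2) \<partial>M) = ennreal ((L2_dist_maps M f g)\<^sup>2)"
  using nn_integral_eq_integral[OF integrable_dist_sq[OF assms]] by (simp add: L2_dist_maps_sq)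

lemma L2_eq_classes: "L2 M (ae_rel M `` {h}) = (\<lambda>f. ae_rel M `` {f}) ` L2_maps M h"
proof -
  have "D2 M (ae_rel M `` {f}) (ae_rel M `` {h}) < \<infinity> \<longleftrightarrow> f \<in> L2_maps M h" if f: "f \<in> borel_measurable M" for f
  proof -
    have meas: "(\<lambda>x. (dist (f x) (h x))\<^sup>2) \<in> borel_measurable M"
      using borel_measurable_dist'[OF f h] by measurable
    have "D2 M (ae_rel M `` {f}) (ae_rel M `` {h}) < \<infinity> \<longleftrightarrow>
        (\<integral>\<^sup>+x. ennreal ((dist (f x) (h x))\<^sup>2) \<partial>M) < \<infinity>"
      using f h by (subst D2_class) (auto simp: L0_maps_eq_borel_measurable[OF sep] D2_maps_def Let_def less_top)
    also have "\<dots> \<longleftrightarrow> integrable M (\<lambda>x. (dist (f x) (h x))\<^sup>2)"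
      using meas by (simp add: integrable_iff_bounded)
    finally show ?thesis using f by (simp add: L2_maps_def)
  qed
  moreover have "L0 M = (\<lambda>f. ae_rel M `` {f}) ` (borel_measurable M :: ('m \<Rightarrow> 'n) set)"
    by (auto simp: L0_def quotient_def L0_maps_eq_borel_measurable[OF sep])
  ultimately show ?thesis by (auto simp: L2_def L2_maps_measurable)
qed

lemma L2_dist_classes:
  assumes "f \<in> L2_maps M h" "g \<in> L2_maps M h"
  shows "L2_dist M (ae_rel M `` {f}) (ae_rel M `` {g}) = L2_dist_maps M f g"
proof -
  have "D2 M (ae_rel M `` {f}) (ae_rel M `` {g}) = D2_maps M f g"
    using assms by (intro D2_class) (auto simp: L0_maps_eq_borel_measurable[OF sep] L2_maps_measurable)
  also have "\<dots> = ennreal (L2_dist_maps M f g)"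
    using nn_integral_dist_sq[OF assms] L2_dist_maps_nonneg[of M f g]
    by (simp add: D2_maps_def Let_def)
  finally show ?thesis by (simp add: L2_dist_def L2_dist_maps_nonneg)
qed

lemma L2_class_eq_iff:
  assumes "f \<in> L2_maps M h" "g \<in> L2_maps M h"
  shows "ae_rel M `` {f} = ae_rel M `` {g} \<longleftrightarrow> (AE x in M. f x = g x)"
  using eq_equiv_class_iff[OF equiv_ae_rel, of f M g] assms
  by (auto simp: L0_maps_eq_borel_measurable[OF sep] L2_maps_measurable ae_rel_def)

lemma Metric_space_L2: "Metric_space (L2 M (ae_rel M `` {h})) (L2_dist M)"
proof
  fix F G K :: "('m \<Rightarrow> 'n) set"
  show "0 \<le> L2_dist M F G" by (simp add: L2_dist_def)
  have sym: "D2_maps M f g = D2_maps M g f" for f g :: "'m \<Rightarrow> 'n"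
    by (simp add: D2_maps_def dist_commute)
  have "(\<lambda>(f, g). D2_maps M f g) ` (G \<times> F) = (\<lambda>p. D2_maps M (snd p) (fst p)) ` (F \<times> G)"
    by (simp add: product_swap[symmetric, of G F] image_image case_prod_unfold)
  also have "\<dots> = (\<lambda>p. D2_maps M (fst p) (snd p)) ` (F \<times> G)"
    by (rule image_cong[OF refl sym])
  finally have "D2 M G F = D2 M F G" by (simp add: D2_def case_prod_unfold)
  then show "L2_dist M F G = L2_dist M G F" by (simp add: L2_dist_def)
  assume F: "F \<in> L2 M (ae_rel M `` {h})" and G: "G \<in> L2 M (ae_rel M `` {h})"
  then obtain f g where fg: "f \<in> L2_maps M h" "g \<in> L2_maps M h" "F = ae_rel M `` {f}" "G = ae_rel M `` {g}"
    unfolding L2_eq_classes by blast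
  show "L2_dist M F G = 0 \<longleftrightarrow> F = G"
    using fg L2_dist_classes L2_dist_maps_eq_0_iff L2_class_eq_iff by simp
  assume "K \<in> L2 M (ae_rel M `` {h})"
  then obtain k where "k \<in> L2_maps M h" "K = ae_rel M `` {k}"
    unfolding L2_eq_classes by blast
  then show "L2_dist M F K \<le> L2_dist M F G + L2_dist M G K"
    using fg L2_dist_classes L2_dist_maps_triangle by simp
qed

section \<open>Transfer of midpoints and of the four-point inequality to \<open>L\<^sup>2\<close>\<close>

text \<open>
  The assumptions say that \<open>\<integral> (dist f k)\<^sup>2 / t + (dist k g)\<^sup>2 / (1 - t)\<close> equals \<open>\<integral> (dist f g)\<^sup>2\<close>. The difference \<open>\<delta>\<close> of
  the integrands is the sum of two nonnegative terms, the defect of the weighted inequality and the one of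
  the triangle inequality. Both therefore vanish almost everywhere.
\<close>

lemma AE_intermediate_point:
  assumes f: "f \<in> L2_maps M h" and g: "g \<in> L2_maps M h" and k: "k \<in> L2_maps M h" and t: "0 < t" "t < 1"
    and fk: "L2_dist_maps M f k = t * L2_dist_maps M f g"
    and kg: "L2_dist_maps M k g = (1 - t) * L2_dist_maps M f g"
  shows "AE x in M. dist (f x) (k x) = t * dist (f x) (g x) \<and> dist (k x) (g x) = (1 - t) * dist (f x) (g x)"
proof -
  define D where "D = L2_dist_maps M f g"
  define \<delta> where "\<delta> x = (dist (f x) (k x))\<^sup>2 / t + (dist (k x) (g x))\<^sup>2 / (1 - t) - (dist (f x) (g x))\<^sup>2" for x
  have ints: "integrable M (\<lambda>x. (dist (f x) (k x))\<^sup>2)" "integrable M (\<lambda>x. (dist (k x) (g x))\<^sup>2)"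
      "integrable M (\<lambda>x. (dist (f x) (g x))\<^sup>2)"
    using f g k by (auto intro: integrable_dist_sq)
  have \<delta>_eq: "\<delta> x = ((1 - t) * dist (f x) (k x) - t * dist (k x) (g x))\<^sup>2 / (t * (1 - t))
      + ((dist (f x) (k x) + dist (k x) (g x))\<^sup>2 - (dist (f x) (g x))\<^sup>2)" for x
    unfolding \<delta>_def weighted_square_defect[OF t, symmetric] by simp
  have parts: "0 \<le> ((1 - t) * dist (f x) (k x) - t * dist (k x) (g x))\<^sup>2 / (t * (1 - t))"
      "0 \<le> (dist (f x) (k x) + dist (k x) (g x))\<^sup>2 - (dist (f x) (g x))\<^sup>2" for x
    using t dist_triangle[of "f x" "g x" "k x"] by (auto intro: power_mono)
  have \<delta>_nonneg: "0 \<le> \<delta> x" for x unfolding \<delta>_eq using parts by (intro add_nonneg_nonneg)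
  have \<delta>_int: "integrable M \<delta>" unfolding \<delta>_def using ints by simp
  have "(\<integral>x. \<delta> x \<partial>M) = (L2_dist_maps M f k)\<^sup>2 / t + (L2_dist_maps M k g)\<^sup>2 / (1 - t) - (L2_dist_maps M f g)\<^sup>2"
    unfolding \<delta>_def L2_dist_maps_sq using ints by simp
  also have "\<dots> = (t * D)\<^sup>2 / t + ((1 - t) * D)\<^sup>2 / (1 - t) - D\<^sup>2"
    by (simp only: fk kg D_def)
  also have "(t * D)\<^sup>2 / t = t * D\<^sup>2" using t by (simp add: power2_eq_square)
  also have "((1 - t) * D)\<^sup>2 / (1 - t) = (1 - t) * D\<^sup>2" using t by (simp add: power2_eq_square)
  also have "t * D\<^sup>2 + (1 - t) * D\<^sup>2 - D\<^sup>2 = 0" by (simp add: left_diff_distrib)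
  finally have "AE x in M. \<delta> x = 0"
    using integral_nonneg_eq_0_iff_AE[OF \<delta>_int] \<delta>_nonneg by simp
  then show ?thesis
  proof eventually_elim
    case (elim x)
    define a b c where "a = dist (f x) (k x)" and "b = dist (k x) (g x)" and "c = dist (f x) (g x)"
    have "((1 - t) * a - t * b)\<^sup>2 / (t * (1 - t)) = 0" "(a + b)\<^sup>2 - c\<^sup>2 = 0"
      using elim parts[of x] unfolding \<delta>_eq a_def b_def c_def by linarith+
    then have "(1 - t) * a = t * b" "(a + b)\<^sup>2 = c\<^sup>2" using t by auto
    moreover from this(2) have "a + b = c" by (simp add: a_def b_def c_def power2_eq_iff_nonneg)
    ultimately have "a = t * c" "b = (1 - t) * c" by (auto simp: algebra_simps)
    then show ?case by (simp add: a_def b_def c_def)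
  qed
qed

lemma four_point_comparison_L2:
  assumes N: "four_point_comparison \<sigma> (UNIV :: 'n set) dist"
  shows "four_point_comparison \<sigma> (L2 M (ae_rel M `` {h})) (L2_dist M)"
  unfolding four_point_comparison_def L2_eq_classes ball_simps
proof (intro ballI impI)
  fix z f g k and t :: real
  assume zfgk: "z \<in> L2_maps M h" "f \<in> L2_maps M h" "g \<in> L2_maps M h" "k \<in> L2_maps M h" and t: "t \<in> {0<..<1}"
    and "L2_dist M (ae_rel M `` {f}) (ae_rel M `` {k}) = t * L2_dist M (ae_rel M `` {f}) (ae_rel M `` {g})"
    and "L2_dist M (ae_rel M `` {k}) (ae_rel M `` {g}) = (1 - t) * L2_dist M (ae_rel M `` {f}) (ae_rel M `` {g})"
  then have "AE x in M. dist (f x) (k x) = t * dist (f x) (g x) \<and> dist (k x) (g x) = (1 - t) * dist (f x) (g x)"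
    by (intro AE_intermediate_point) (auto simp: L2_dist_classes)
  then have "AE x in M. 0 \<le> \<sigma> * ((dist (z x) (k x))\<^sup>2 - ((1 - t) * (dist (z x) (f x))\<^sup>2
      + t * (dist (z x) (g x))\<^sup>2 - (1 - t) * t * (dist (f x) (g x))\<^sup>2))"
  proof eventually_elim
    case (elim x)
    then show ?case using N t unfolding four_point_comparison_def by blast
  qed
  then have "0 \<le> (\<integral>x. \<sigma> * ((dist (z x) (k x))\<^sup>2 - ((1 - t) * (dist (z x) (f x))\<^sup>2
      + t * (dist (z x) (g x))\<^sup>2 - (1 - t) * t * (dist (f x) (g x))\<^sup>2)) \<partial>M)"
    by (rule integral_nonneg_AE)
  also have "\<dots> = \<sigma> * ((L2_dist_maps M z k)\<^sup>2 - ((1 - t) * (L2_dist_maps M z f)\<^sup>2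
      + t * (L2_dist_maps M z g)\<^sup>2 - (1 - t) * t * (L2_dist_maps M f g)\<^sup>2))"
    unfolding L2_dist_maps_sq using zfgk integrable_dist_sq by simp
  finally show "0 \<le> \<sigma> * ((L2_dist M (ae_rel M `` {z}) (ae_rel M `` {k}))\<^sup>2
      - ((1 - t) * (L2_dist M (ae_rel M `` {z}) (ae_rel M `` {f}))\<^sup>2
      + t * (L2_dist M (ae_rel M `` {z}) (ae_rel M `` {g}))\<^sup>2
      - (1 - t) * t * (L2_dist M (ae_rel M `` {f}) (ae_rel M `` {g}))\<^sup>2))"
    using zfgk by (simp add: L2_dist_classes)
qed

text \<open>
  The selection theorem is applied on \<open>N \<times> N\<close> to the closed relation "is a midpoint of", with the image under
  \<open>(f, g)\<close> of the finite measure with density \<open>w = (dist f g)\<^sup>2\<close>. This measure does not see the set where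
  \<open>f = g\<close>, but there the midpoint is \<open>f\<close>.
\<close>

lemma has_midpoints_L2:
  assumes complete: "complete (UNIV :: 'n set)" and mid: "has_midpoints (UNIV :: 'n set) dist"
  shows "has_midpoints (L2 M (ae_rel M `` {h})) (L2_dist M)"
  unfolding has_midpoints_def L2_eq_classes ball_simps bex_simps
proof (intro ballI)
  fix f g assume fg: "f \<in> L2_maps M h" "g \<in> L2_maps M h"
  define C :: "(('n \<times> 'n) \<times> 'n) set"
    where "C = {p. dist (fst (fst p)) (snd p) = dist (fst (fst p)) (snd (fst p)) / 2
      \<and> dist (snd p) (snd (fst p)) = dist (fst (fst p)) (snd (fst p)) / 2}"
  have "closed C"
    unfolding C_def by (intro closed_Collect_conj closed_Collect_eq continuous_intros) auto
  have C_ex: "\<exists>y. (z, y) \<in> C" for z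
    using mid by (auto simp: C_def has_midpoints_def)
  define w where "w x = ennreal ((dist (f x) (g x))\<^sup>2)" for x
  have f: "f \<in> borel_measurable M" and g: "g \<in> borel_measurable M"
    using fg by (auto simp: L2_maps_measurable)
  have w: "w \<in> borel_measurable M"
    unfolding w_def using borel_measurable_dist'[OF f g] by measurable
  define P where "P = distr (density M w) borel (\<lambda>x. (f x, g x))"
  have fg_meas: "(\<lambda>x. (f x, g x)) \<in> borel_measurable M"
    by (rule borel_measurable_Pair_separable[OF sep f g])
  have "finite_measure (density M w)"
  proof
    have "emeasure (density M w) (space M) = ennreal ((L2_dist_maps M f g)\<^sup>2)"
      using w nn_integral_dist_sq[OF fg] by (simp add: emeasure_density w_def cong: nn_integral_cong)
    then show "emeasure (density M w) (space (density M w)) \<noteq> \<infinity>" by simp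
  qed
  then have P: "finite_measure P"
    unfolding P_def using fg_meas by (intro finite_measure.finite_measure_distr) simp_all
  obtain s where s: "s \<in> borel_measurable borel" and s_C: "AE z in P. (z, s z) \<in> C"
    using measurable_selection_ae[OF sep complete \<open>closed C\<close> C_ex P] by (auto simp: P_def)
  have "AE x in density M w. ((f x, g x), s (f x, g x)) \<in> C"
    using s_C unfolding P_def by (rule AE_distrD[rotated]) (use fg_meas in simp)
  then have AE_C: "AE x in M. 0 < w x \<longrightarrow> ((f x, g x), s (f x, g x)) \<in> C"
    using w by (simp add: AE_density)
  define k where "k x = (if w x = 0 then f x else s (f x, g x))" for x
  have k: "k \<in> borel_measurable M"
  proof -
    have "(\<lambda>x. s (f x, g x)) \<in> borel_measurable M" by (rule measurable_compose[OF fg_meas s])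
    then show ?thesis unfolding k_def using f w by (intro measurable_If) auto
  qed
  have AE_mid: "AE x in M. dist (f x) (k x) = dist (f x) (g x) / 2 \<and> dist (k x) (g x) = dist (f x) (g x) / 2"
    using AE_C
  proof eventually_elim
    case (elim x)
    show ?case
    proof (cases "w x = 0")
      case True then show ?thesis by (simp add: k_def w_def)
    next
      case False
      then show ?thesis using elim by (auto simp: k_def C_def zero_less_iff_neq_zero)
    qed
  qed
  have eq_fk: "AE x in M. (dist (f x) (k x))\<^sup>2 = (dist (f x) (g x))\<^sup>2 / 4"
    using AE_mid
  proof eventually_elim
    case (elim x)
    show ?case unfolding conjunct1[OF elim] by (simp add: power_divide)
  qed
  have eq_kg: "AE x in M. (dist (k x) (g x))\<^sup>2 = (dist (f x) (g x))\<^sup>2 / 4"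
    using AE_mid
  proof eventually_elim
    case (elim x)
    show ?case unfolding conjunct2[OF elim] by (simp add: power_divide)
  qed
  have meas: "(\<lambda>x. (dist (f x) (k x))\<^sup>2) \<in> borel_measurable M" "(\<lambda>x. (dist (k x) (g x))\<^sup>2) \<in> borel_measurable M"
      "(\<lambda>x. (dist (f x) (g x))\<^sup>2 / 4) \<in> borel_measurable M"
    using borel_measurable_dist'[OF f k] borel_measurable_dist'[OF k g] borel_measurable_dist'[OF f g] by measurable
  have "integrable M (\<lambda>x. (dist (f x) (k x))\<^sup>2)"
    using integrable_cong_AE[OF meas(1,3) eq_fk] integrable_dist_sq[OF fg] by simp
  then have k_L2: "k \<in> L2_maps M h" by (rule L2_mapsI[OF fg(1) k])
  have "L2_dist_maps M f k = L2_dist_maps M f g / 2" "L2_dist_maps M k g = L2_dist_maps M f g / 2"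
    unfolding L2_dist_maps_def integral_cong_AE[OF meas(1,3) eq_fk] integral_cong_AE[OF meas(2,3) eq_kg]
    by (simp_all add: real_sqrt_divide)
  then show "\<exists>k\<in>L2_maps M h.
      L2_dist M (ae_rel M `` {f}) (ae_rel M `` {k}) = L2_dist M (ae_rel M `` {f}) (ae_rel M `` {g}) / 2 \<and>
      L2_dist M (ae_rel M `` {k}) (ae_rel M `` {g}) = L2_dist M (ae_rel M `` {f}) (ae_rel M `` {g}) / 2"
    using fg k_L2 by (intro bexI[of _ k]) (simp_all add: L2_dist_classes)
qed

end

section \<open>Completeness of \<open>L\<^sup>2\<close>\<close>

lemma cauchy_fast_subsequence:
  fixes e :: "nat \<Rightarrow> real"
  assumes X: "Metric_space X d" and \<sigma>: "Metric_space.MCauchy X d \<sigma>" and e: "\<And>n. e n > 0"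
  obtains r :: "nat \<Rightarrow> nat" where "strict_mono r" "\<And>n m. r n \<le> m \<Longrightarrow> d (\<sigma> (r n)) (\<sigma> m) < e n"
proof -
  interpret Metric_space X d by (rule X)
  have "\<exists>N. \<forall>n n'. N \<le> n \<longrightarrow> N \<le> n' \<longrightarrow> d (\<sigma> n) (\<sigma> n') < e k" for k
    using \<sigma> e[of k] unfolding MCauchy_def by blast
  then obtain N where N: "\<And>k n n'. N k \<le> n \<Longrightarrow> N k \<le> n' \<Longrightarrow> d (\<sigma> n) (\<sigma> n') < e k" by metis
  define r where "r n = n + (\<Sum>i\<le>n. N i)" for n
  have "strict_mono r" by (rule strict_mono_Suc_iff[THEN iffD2]) (simp add: r_def)
  moreover have "N n \<le> r n" for n
    unfolding r_def by (simp add: trans_le_add2 member_le_sum)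
  then have "d (\<sigma> (r n)) (\<sigma> m) < e n" if "r n \<le> m" for n m
    using N[of n "r n" m] that order_trans by blast
  ultimately show thesis using that by blast
qed

text \<open>
  The sum of \<open>4 ^ n * (dist (f n) (f (n + 1)))\<^sup>2\<close> has integral at most \<open>\<Sum>(4 / 8) ^ n\<close>, so it is finite almost
  everywhere, and where it is finite the \<open>n\<close>-th distance is at most a constant times \<open>(1/2) ^ n\<close>.
\<close>

lemma AE_summable_dist_if_small_L2_steps:
  fixes f :: "nat \<Rightarrow> 'm \<Rightarrow> 'n::metric_space"
  assumes meas: "\<And>n. (\<lambda>x. dist (f n x) (f (Suc n) x)) \<in> borel_measurable M"
    and small: "\<And>n. (\<integral>\<^sup>+x. ennreal ((dist (f n x) (f (Suc n) x))\<^sup>2) \<partial>M) \<le> ennreal ((1/8) ^ n)"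
  obtains G where "G \<in> sets M" "AE x in M. x \<in> G"
    "\<And>x. x \<in> G \<Longrightarrow> summable (\<lambda>n. dist (f n x) (f (Suc n) x))"
proof -
  define u where "u n x = ennreal (4 ^ n * (dist (f n x) (f (Suc n) x))\<^sup>2)" for n x
  define S where "S x = (\<Sum>n. u n x)" for x
  have u: "u n \<in> borel_measurable M" for n unfolding u_def using meas[of n] by measurable
  have S: "S \<in> borel_measurable M" unfolding S_def using u by measurable
  have "integral\<^sup>N M (u n) \<le> ennreal ((1/2) ^ n)" for n
  proof -
    have "integral\<^sup>N M (u n) = ennreal (4 ^ n) * (\<integral>\<^sup>+x. ennreal ((dist (f n x) (f (Suc n) x))\<^sup>2) \<partial>M)"
      unfolding u_def using meas[of n] by (subst nn_integral_cmult[symmetric]) (auto simp: ennreal_mult)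
    also have "\<dots> \<le> ennreal (4 ^ n) * ennreal ((1/8) ^ n)"
      using small by (rule mult_left_mono) simp
    also have "\<dots> = ennreal ((1/2) ^ n)"
      by (simp add: ennreal_mult[symmetric] power_mult_distrib[symmetric])
    finally show ?thesis .
  qed
  then have "(\<Sum>n. integral\<^sup>N M (u n)) \<le> (\<Sum>n. ennreal ((1/2) ^ n))"
    by (intro suminf_le) auto
  also have "\<dots> = ennreal (\<Sum>n. (1/2) ^ n)"
    by (intro suminf_ennreal2 summable_geometric) auto
  also have "\<dots> < \<infinity>" by simp
  finally have "integral\<^sup>N M S < \<infinity>"
    unfolding S_def using u by (simp add: nn_integral_suminf)
  then have AE: "AE x in M. S x \<noteq> \<infinity>"
    using S by (intro nn_integral_PInf_AE) auto
  define G where "G = {x \<in> space M. S x \<noteq> \<infinity>}"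
  show thesis
  proof (rule that[of G])
    show "G \<in> sets M" unfolding G_def using S by measurable
    show "AE x in M. x \<in> G" using AE AE_space by eventually_elim (auto simp: G_def)
    fix x assume "x \<in> G"
    then have fin: "S x < \<infinity>" by (simp add: G_def less_top)
    have bound: "dist (f n x) (f (Suc n) x) \<le> sqrt (enn2real (S x)) * (1/2) ^ n" for n
    proof -
      have "u n x \<le> S x" unfolding S_def by (rule sum_le_suminf[of "\<lambda>n. u n x" "{n}", simplified])
      then have "4 ^ n * (dist (f n x) (f (Suc n) x))\<^sup>2 \<le> enn2real (S x)"
        using fin unfolding u_def by (cases "S x") auto
      moreover have "(2 :: real) ^ n * 2 ^ n = 4 ^ n" by (simp flip: power_mult_distrib)
      then have scale: "(2 ^ n * dist (f n x) (f (Suc n) x))\<^sup>2 = 4 ^ n * (dist (f n x) (f (Suc n) x))\<^sup>2"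
        by (metis power_mult_distrib power2_eq_square)
      ultimately have "(2 ^ n * dist (f n x) (f (Suc n) x))\<^sup>2 \<le> enn2real (S x)"
        by simp
      then have "2 ^ n * dist (f n x) (f (Suc n) x) \<le> sqrt (enn2real (S x))"
        by (rule real_le_rsqrt)
      then show ?thesis by (simp add: field_simps power_divide)
    qed
    show "summable (\<lambda>n. dist (f n x) (f (Suc n) x))"
      by (rule summable_comparison_test'[where N = 0 and g = "\<lambda>n. sqrt (enn2real (S x)) * (1/2) ^ n"])
        (use bound in \<open>auto intro: summable_mult summable_geometric\<close>)
  qed
qed

context
  fixes M :: "'m measure" and h :: "'m \<Rightarrow> 'n::metric_space"
  assumes sep: "separable_space (euclidean :: 'n topology)" and h: "h \<in> borel_measurable M"
begin

lemma mcomplete_L2: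
  assumes complete: "complete (UNIV :: 'n set)"
  shows "Metric_space.mcomplete (L2 M (ae_rel M `` {h})) (L2_dist M)"
proof -
  let ?cls = "\<lambda>f. ae_rel M `` {f}"
  interpret L2: Metric_space "L2 M (?cls h)" "L2_dist M" by (rule Metric_space_L2[OF sep h])
  have "\<exists>F. limitin L2.mtopology \<sigma> F sequentially" if \<sigma>: "L2.MCauchy \<sigma>" for \<sigma>
  proof -
    have "range \<sigma> \<subseteq> L2 M (?cls h)"
      using \<sigma> unfolding L2.MCauchy_def by blast
    then have "range \<sigma> \<subseteq> ?cls ` L2_maps M h"
      unfolding L2_eq_classes[OF sep h] .
    then have "\<exists>f. f \<in> L2_maps M h \<and> \<sigma> n = ?cls f" for n by auto
    then obtain f where f: "\<And>n. f n \<in> L2_maps M h" and \<sigma>_eq: "\<And>n. \<sigma> n = ?cls (f n)" by metis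
    obtain r where r: "strict_mono r"
      "\<And>n m. r n \<le> m \<Longrightarrow> L2_dist M (\<sigma> (r n)) (\<sigma> m) < sqrt ((1/8) ^ n)"
      using cauchy_fast_subsequence[OF L2.Metric_space_axioms \<sigma>, of "\<lambda>n. sqrt ((1/8) ^ n)"] by auto
    have nn: "(\<integral>\<^sup>+x. ennreal ((dist (f (r n) x) (f (r m) x))\<^sup>2) \<partial>M) \<le> ennreal ((1/8) ^ n)"
      if "n \<le> m" for n m
    proof -
      have "L2_dist_maps M (f (r n)) (f (r m)) < sqrt ((1/8) ^ n)"
        using r(2)[of n "r m"] r(1) that f by (simp add: \<sigma>_eq L2_dist_classes[OF sep h] strict_mono_less_eq)
      then have "(L2_dist_maps M (f (r n)) (f (r m)))\<^sup>2 \<le> (sqrt ((1/8) ^ n))\<^sup>2"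
        by (intro power_mono) (auto simp: L2_dist_maps_nonneg)
      then show ?thesis
        unfolding nn_integral_dist_sq[OF sep h f f] by (intro ennreal_leI) simp
    qed
    have f_meas: "f n \<in> borel_measurable M" for n using f by (rule L2_maps_measurable[OF sep h])
    obtain G where G: "G \<in> sets M" "AE x in M. x \<in> G"
      "\<And>x. x \<in> G \<Longrightarrow> summable (\<lambda>n. dist (f (r n) x) (f (r (Suc n)) x))"
      using AE_summable_dist_if_small_L2_steps[of "\<lambda>n. f (r n)" M]
        borel_measurable_dist_separable[OF sep f_meas f_meas] nn[OF le_SucI[OF order_refl]] by blast
    \<comment> \<open>Replacing the maps by \<open>h\<close> on a null set gives convergence everywhere, so that the limit is
       measurable.\<close>
    define g where "g n x = (if x \<in> G then f (r n) x else h x)" for n x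
    have g: "g n \<in> borel_measurable M" for n
      unfolding g_def using f_meas h G(1) by (intro measurable_If_set) auto
    have "\<exists>l. (\<lambda>n. g n x) \<longlonglongrightarrow> l" for x
    proof (cases "x \<in> G")
      case True
      have "Metric_space.MCauchy UNIV dist (\<lambda>n. f (r n) x)"
        by (rule Metric_space.MCauchy_if_summable_steps[OF Met_TC.Metric_space_axioms _ order_refl G(3)[OF True]]) simp
      then have "Cauchy (\<lambda>n. f (r n) x)" by simp
      then show ?thesis using complete True unfolding complete_def g_def by auto
    next
      case False then show ?thesis unfolding g_def by auto
    qed
    then obtain F where F: "\<And>x. (\<lambda>n. g n x) \<longlonglongrightarrow> F x" by metis
    have F_meas: "F \<in> borel_measurable M"
      using borel_measurable_LIMSEQ_metric[of g M F] g F by blast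
    have F_lim: "(\<integral>\<^sup>+x. ennreal ((dist (f (r n) x) (F x))\<^sup>2) \<partial>M) \<le> ennreal ((1/8) ^ n)" for n
    proof -
      let ?u = "\<lambda>m x. ennreal ((dist (f (r n) x) (f (r m) x))\<^sup>2)"
      have "(\<integral>\<^sup>+x. ennreal ((dist (f (r n) x) (F x))\<^sup>2) \<partial>M) = (\<integral>\<^sup>+x. liminf (\<lambda>m. ?u m x) \<partial>M)"
      proof (rule nn_integral_cong_AE)
        show "AE x in M. ennreal ((dist (f (r n) x) (F x))\<^sup>2) = liminf (\<lambda>m. ?u m x)"
          using G(2)
        proof eventually_elim
          case (elim x)
          then have "(\<lambda>m. f (r m) x) \<longlonglongrightarrow> F x" using F[of x] by (simp add: g_def)
          then have "(\<lambda>m. ?u m x) \<longlonglongrightarrow> ennreal ((dist (f (r n) x) (F x))\<^sup>2)"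
            by (intro tendsto_intros)
          then show ?case using lim_imp_Liminf[OF trivial_limit_sequentially] by metis
        qed
      qed
      also have "\<dots> \<le> liminf (\<lambda>m. \<integral>\<^sup>+x. ?u m x \<partial>M)"
      proof (rule nn_integral_liminf)
        show "?u m \<in> borel_measurable M" for m
          using borel_measurable_dist_separable[OF sep f_meas f_meas] by measurable
      qed
      also have "\<dots> \<le> liminf (\<lambda>m. ennreal ((1/8) ^ n))"
        by (intro Liminf_mono eventually_sequentiallyI[of n] nn)
      finally show ?thesis by (simp add: Liminf_const)
    qed
    have int: "integrable M (\<lambda>x. (dist (f (r 0) x) (F x))\<^sup>2)"
    proof (rule integrableI_bounded)
      show "(\<lambda>x. (dist (f (r 0) x) (F x))\<^sup>2) \<in> borel_measurable M"
        using borel_measurable_dist_separable[OF sep f_meas F_meas] by measurable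
      show "(\<integral>\<^sup>+x. ennreal (norm ((dist (f (r 0) x) (F x))\<^sup>2)) \<partial>M) < \<infinity>"
        using F_lim[of 0] by (simp add: le_less_trans)
    qed
    have F_L2: "F \<in> L2_maps M h" by (rule L2_mapsI[OF sep h f F_meas int])
    have bound: "L2_dist M ((\<sigma> \<circ> r) n) (?cls F) \<le> sqrt ((1/8) ^ n)" for n
    proof -
      have "(L2_dist_maps M (f (r n)) F)\<^sup>2 \<le> (1/8) ^ n"
        using F_lim[of n] unfolding nn_integral_dist_sq[OF sep h f F_L2] by simp
      then show ?thesis
        using f F_L2 by (simp add: \<sigma>_eq L2_dist_classes[OF sep h] real_le_rsqrt)
    qed
    have "limitin L2.mtopology (\<sigma> \<circ> r) (?cls F) sequentially"
      unfolding L2.limitin_metric_dist_null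
    proof (intro conjI)
      show "?cls F \<in> L2 M (?cls h)" using F_L2 unfolding L2_eq_classes[OF sep h] by blast
      show "\<forall>\<^sub>F n in sequentially. (\<sigma> \<circ> r) n \<in> L2 M (?cls h)"
        using f unfolding L2_eq_classes[OF sep h] by (simp add: \<sigma>_eq)
      have "(\<lambda>n. sqrt ((1/8) ^ n)) \<longlonglongrightarrow> sqrt 0"
        by (intro tendsto_real_sqrt LIMSEQ_power_zero) simp
      then have "(\<lambda>n. sqrt ((1/8) ^ n)) \<longlonglongrightarrow> 0" by simp
      then show "(\<lambda>n. L2_dist M ((\<sigma> \<circ> r) n) (?cls F)) \<longlonglongrightarrow> 0"
        by (rule Lim_null_comparison[rotated]) (use bound in \<open>auto simp: L2.nonneg\<close>)
    qed
    then show ?thesis using L2.MCauchy_convergent_subsequence[OF \<sigma> r(1)] by blast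
  qed
  then show ?thesis unfolding L2.mcomplete_def by blast
qed

section \<open>A copy of \<open>N\<close> in \<open>L\<^sup>2\<close>\<close>

text \<open>
  A set of finite positive measure is the increasing union of its parts where \<open>h\<close> is within distance \<open>n\<close> of
  \<open>p\<close>. The bound is what puts the maps that are constant on \<open>A\<close> into \<open>L\<^sup>2\<close>.
\<close>

lemma set_of_positive_measure_near_constant:
  fixes p :: 'n
  assumes "\<not> purely_infinite M"
  obtains A R where "A \<in> sets M" "0 < emeasure M A" "emeasure M A < \<infinity>" "\<And>x. x \<in> A \<Longrightarrow> dist p (h x) \<le> R"
proof -
  obtain B where B: "B \<in> sets M" "emeasure M B \<noteq> 0" "emeasure M B \<noteq> \<infinity>"
    using assms by (auto simp: purely_infinite_def)
  define A where "A n = B \<inter> {x \<in> space M. dist p (h x) \<le> real n}" for n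
  have A: "A n \<in> sets M" for n
    unfolding A_def using B(1) borel_measurable_dist_separable[OF sep measurable_const h, of p] by measurable
  have "\<exists>n. emeasure M (A n) \<noteq> 0"
  proof (rule ccontr)
    assume "\<not> (\<exists>n. emeasure M (A n) \<noteq> 0)"
    then have "emeasure M (\<Union>n. A n) = 0" using A by (intro emeasure_UN_eq_0) auto
    moreover have "B \<subseteq> (\<Union>n. A n)"
    proof
      fix x assume x: "x \<in> B"
      obtain n where "dist p (h x) \<le> real n" using real_arch_simple by blast
      then show "x \<in> (\<Union>n. A n)"
        using x sets.sets_into_space[OF B(1)] by (intro UN_I[of n]) (auto simp: A_def)
    qed
    then have "B = (\<Union>n. A n)" by (auto simp: A_def)
    ultimately show False using B(2) by simp
  qed
  then obtain n where n: "emeasure M (A n) \<noteq> 0" ..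
  have "emeasure M (A n) \<le> emeasure M B" using B(1) by (intro emeasure_mono) (auto simp: A_def)
  also have "\<dots> < \<infinity>" using B(3) by (simp add: less_top)
  finally have fin: "emeasure M (A n) < \<infinity>" .
  have pos: "0 < emeasure M (A n)" using n by (simp add: zero_less_iff_neq_zero)
  have "dist p (h x) \<le> real n" if "x \<in> A n" for x using that by (simp add: A_def)
  then show thesis by (rule that[OF A pos fin])
qed

context
  fixes A :: "'m set" and p\<^sub>0 :: 'n and R :: real
  assumes A: "A \<in> sets M" "0 < emeasure M A" "emeasure M A < \<infinity>"
    and R: "\<And>x. x \<in> A \<Longrightarrow> dist p\<^sub>0 (h x) \<le> R"
begin

definition patch :: "'n \<Rightarrow> 'm \<Rightarrow> 'n" where
  "patch p x = (if x \<in> A then p else h x)"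

lemma measure_A_pos: "0 < measure M A"
  using A by (simp add: measure_def enn2real_positive_iff)

lemma patch_L2_maps: "patch p \<in> L2_maps M h"
proof -
  have meas: "patch p \<in> borel_measurable M"
    unfolding patch_def[abs_def] using h A(1) by (intro measurable_If_set) auto
  have "integrable M (\<lambda>x. (dist (patch p x) (h x))\<^sup>2)"
  proof (rule Bochner_Integration.integrable_bound)
    show "integrable M (\<lambda>x. (dist p p\<^sub>0 + R)\<^sup>2 * indicator A x)" using A by simp
    show "(\<lambda>x. (dist (patch p x) (h x))\<^sup>2) \<in> borel_measurable M"
      using borel_measurable_dist_separable[OF sep meas h] by measurable
    have "(dist p (h x))\<^sup>2 \<le> (dist p p\<^sub>0 + R)\<^sup>2" if "x \<in> A" for x
      using R[OF that] dist_triangle[of p "h x" p\<^sub>0] by (intro power_mono) auto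
    then show "AE x in M. norm ((dist (patch p x) (h x))\<^sup>2) \<le> norm ((dist p p\<^sub>0 + R)\<^sup>2 * indicator A x)"
      by (intro AE_I2) (auto simp: patch_def indicator_def)
  qed
  then show ?thesis using meas by (simp add: L2_maps_def)
qed

lemma L2_dist_patch_sq: "(L2_dist_maps M (patch p) (patch q))\<^sup>2 = measure M A * (dist p q)\<^sup>2"
proof -
  have "(\<lambda>x. (dist (patch p x) (patch q x))\<^sup>2) = (\<lambda>x. indicator A x * (dist p q)\<^sup>2)"
    by (auto simp: patch_def indicator_def)
  then show ?thesis using A by (simp add: L2_dist_maps_sq)
qed

lemma L2_dist_patch:
  "L2_dist_maps M (patch p) (patch q) = sqrt (measure M A) * dist p q"
  using L2_dist_patch_sq[of p q] L2_dist_maps_nonneg[of M]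
  by (metis abs_of_nonneg real_sqrt_abs real_sqrt_mult zero_le_dist)

lemma AE_imp_exists_in_A:
  assumes "AE x in M. Q x"
  shows "\<exists>x\<in>A. Q x"
proof (rule ccontr)
  assume none: "\<not> (\<exists>x\<in>A. Q x)"
  have "AE x in M. x \<notin> A" using assms by eventually_elim (use none in auto)
  then have "emeasure M A = 0" using A(1) sets.sets_into_space by (subst (asm) AE_iff_measurable[OF A(1)]) auto
  then show False using A(2) by simp
qed

lemma four_point_comparison_from_L2:
  assumes "four_point_comparison \<sigma> (L2 M (ae_rel M `` {h})) (L2_dist M)"
  shows "four_point_comparison \<sigma> (UNIV :: 'n set) dist"
  unfolding four_point_comparison_def
proof (intro ballI impI)
  fix z x y m :: 'n and t :: real
  assume t: "t \<in> {0<..<1}" and m: "dist x m = t * dist x y" "dist m y = (1 - t) * dist x y"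
  let ?c = "\<lambda>p. ae_rel M `` {patch p}"
  have in_L2: "?c p \<in> L2 M (ae_rel M `` {h})" for p
    using patch_L2_maps unfolding L2_eq_classes[OF sep h] by blast
  have dist_c: "L2_dist M (?c p) (?c q) = sqrt (measure M A) * dist p q" for p q
    using L2_dist_classes[OF sep h patch_L2_maps patch_L2_maps] by (simp add: L2_dist_patch)
  have "L2_dist M (?c x) (?c m) = t * L2_dist M (?c x) (?c y)"
      "L2_dist M (?c m) (?c y) = (1 - t) * L2_dist M (?c x) (?c y)"
    unfolding dist_c m by simp_all
  then have "0 \<le> \<sigma> * ((L2_dist M (?c z) (?c m))\<^sup>2 - ((1 - t) * (L2_dist M (?c z) (?c x))\<^sup>2
      + t * (L2_dist M (?c z) (?c y))\<^sup>2 - (1 - t) * t * (L2_dist M (?c x) (?c y))\<^sup>2))"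
    using assms in_L2 t unfolding four_point_comparison_def by blast
  also have "\<dots> = measure M A * (\<sigma> * ((dist z m)\<^sup>2 - ((1 - t) * (dist z x)\<^sup>2 + t * (dist z y)\<^sup>2
      - (1 - t) * t * (dist x y)\<^sup>2)))"
    unfolding dist_c by (simp add: power_mult_distrib algebra_simps)
  finally show "0 \<le> \<sigma> * ((dist z m)\<^sup>2 - ((1 - t) * (dist z x)\<^sup>2 + t * (dist z y)\<^sup>2
      - (1 - t) * t * (dist x y)\<^sup>2))"
    using measure_A_pos by (simp add: zero_le_mult_iff)
qed

lemma has_midpoints_from_L2:
  assumes "has_midpoints (L2 M (ae_rel M `` {h})) (L2_dist M)"
  shows "has_midpoints (UNIV :: 'n set) dist"
  unfolding has_midpoints_def
proof (intro ballI)
  fix p q :: 'n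
  note L2s = patch_L2_maps[of p] patch_L2_maps[of q]
  obtain k where k: "k \<in> L2_maps M h"
      "L2_dist_maps M (patch p) k = L2_dist_maps M (patch p) (patch q) / 2"
      "L2_dist_maps M k (patch q) = L2_dist_maps M (patch p) (patch q) / 2"
    using assms L2s unfolding has_midpoints_def L2_eq_classes[OF sep h] ball_simps bex_simps
    by (auto simp: L2_dist_classes[OF sep h])
  have "AE x in M. dist (patch p x) (k x) = 1/2 * dist (patch p x) (patch q x) \<and>
      dist (k x) (patch q x) = (1 - 1/2) * dist (patch p x) (patch q x)"
    using k by (intro AE_intermediate_point[OF sep h] L2s) auto
  then obtain x where "x \<in> A" "dist (patch p x) (k x) = 1/2 * dist (patch p x) (patch q x)"
      "dist (k x) (patch q x) = (1 - 1/2) * dist (patch p x) (patch q x)"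
    using AE_imp_exists_in_A by blast
  then show "\<exists>m\<in>UNIV. dist p m = dist p q / 2 \<and> dist m q = dist p q / 2"
    by (intro bexI[of _ "k x"]) (auto simp: patch_def)
qed

text \<open>
  A Cauchy sequence \<open>p\<close> of \<open>N\<close> gives a sequence of the copy that converges in \<open>L\<^sup>2\<close> to some \<open>f\<close>. By Fatou's
  lemma some \<open>x\<close> in \<open>A\<close> has \<open>dist (p n) (f x)\<close> with lower limit \<open>0\<close>. As \<open>p\<close> is Cauchy, these distances
  converge, so \<open>p\<close> converges to \<open>f x\<close>.
\<close>

lemma complete_from_L2:
  assumes "Metric_space.mcomplete (L2 M (ae_rel M `` {h})) (L2_dist M)"
  shows "complete (UNIV :: 'n set)"
  unfolding complete_def
proof (intro allI impI)
  fix p :: "nat \<Rightarrow> 'n" assume "(\<forall>n. p n \<in> UNIV) \<and> Cauchy p"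
  then have p: "Cauchy p" by simp
  let ?cls = "\<lambda>f. ae_rel M `` {f}"
  interpret L2: Metric_space "L2 M (?cls h)" "L2_dist M" by (rule Metric_space_L2[OF sep h])
  define \<sigma> where "\<sigma> n = ?cls (patch (p n))" for n
  have dist_\<sigma>: "L2_dist M (\<sigma> n) (\<sigma> m) = sqrt (measure M A) * dist (p n) (p m)" for n m
    unfolding \<sigma>_def using L2_dist_classes[OF sep h patch_L2_maps patch_L2_maps]
    by (simp add: L2_dist_patch)
  have "L2.MCauchy \<sigma>"
    unfolding L2.MCauchy_def
  proof (intro conjI allI impI)
    show "range \<sigma> \<subseteq> L2 M (?cls h)"
      unfolding \<sigma>_def L2_eq_classes[OF sep h] using patch_L2_maps by blast
    fix e :: real assume "e > 0"
    then have "e / sqrt (measure M A) > 0" using measure_A_pos by simp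
    then obtain N where "\<And>m n. m \<ge> N \<Longrightarrow> n \<ge> N \<Longrightarrow> dist (p m) (p n) < e / sqrt (measure M A)"
      using metric_CauchyD[OF p] by blast
    then show "\<exists>N. \<forall>n n'. N \<le> n \<longrightarrow> N \<le> n' \<longrightarrow> L2_dist M (\<sigma> n) (\<sigma> n') < e"
      unfolding dist_\<sigma> using measure_A_pos by (intro exI[of _ N]) (auto simp: field_simps)
  qed
  then obtain F where F: "limitin L2.mtopology \<sigma> F sequentially"
    using assms unfolding L2.mcomplete_def by blast
  then have "F \<in> L2 M (?cls h)" by (simp add: L2.limitin_metric)
  then obtain f where f: "f \<in> L2_maps M h" "F = ?cls f"
    unfolding L2_eq_classes[OF sep h] by blast
  have lim: "(\<lambda>n. L2_dist_maps M (patch (p n)) f) \<longlonglongrightarrow> 0"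
    using F unfolding L2.limitin_metric_dist_null \<sigma>_def f(2)
    by (simp add: L2_dist_classes[OF sep h] patch_L2_maps f(1))
  let ?u = "\<lambda>n x. ennreal ((dist (patch (p n) x) (f x))\<^sup>2)"
  have "(\<integral>\<^sup>+x. liminf (\<lambda>n. ?u n x) \<partial>M) \<le> liminf (\<lambda>n. \<integral>\<^sup>+x. ?u n x \<partial>M)"
  proof (rule nn_integral_liminf)
    show "?u n \<in> borel_measurable M" for n
      using borel_measurable_dist_separable[OF sep, of "patch (p n)" M f]
        L2_maps_measurable[OF sep h] patch_L2_maps f(1) by measurable
  qed
  also have "\<dots> = liminf (\<lambda>n. ennreal ((L2_dist_maps M (patch (p n)) f)\<^sup>2))"
    by (simp add: nn_integral_dist_sq[OF sep h patch_L2_maps f(1)])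
  also have "\<dots> = ennreal (0\<^sup>2)"
    by (intro lim_imp_Liminf trivial_limit_sequentially tendsto_intros lim)
  finally have "(\<integral>\<^sup>+x. liminf (\<lambda>n. ?u n x) \<partial>M) = 0" by simp
  moreover have "(\<lambda>x. liminf (\<lambda>n. ?u n x)) \<in> borel_measurable M"
  proof (rule borel_measurable_liminf)
    show "?u n \<in> borel_measurable M" for n
      using borel_measurable_dist_separable[OF sep, of "patch (p n)" M f]
        L2_maps_measurable[OF sep h] patch_L2_maps f(1) by measurable
  qed
  ultimately have "AE x in M. liminf (\<lambda>n. ?u n x) = 0"
    by (simp add: nn_integral_0_iff_AE)
  then obtain x where x: "x \<in> A" "liminf (\<lambda>n. ?u n x) = 0" using AE_imp_exists_in_A by blast
  have "Cauchy (\<lambda>n. dist (p n) (f x))"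
  proof (rule metric_CauchyI)
    fix e :: real assume "e > 0"
    then obtain N where N: "\<And>m n. m \<ge> N \<Longrightarrow> n \<ge> N \<Longrightarrow> dist (p m) (p n) < e"
      using metric_CauchyD[OF p] by blast
    have "\<bar>dist (p m) (f x) - dist (p n) (f x)\<bar> \<le> dist (p m) (p n)" for m n
      using dist_triangle[of "p m" "f x" "p n"] dist_triangle3[of "p n" "f x" "p m"] by (simp add: abs_le_iff dist_commute)
    then show "\<exists>N. \<forall>m\<ge>N. \<forall>n\<ge>N. dist (dist (p m) (f x)) (dist (p n) (f x)) < e"
      using N unfolding dist_real_def by (meson le_less_trans)
  qed
  then obtain l where l: "(\<lambda>n. dist (p n) (f x)) \<longlonglongrightarrow> l"
    using Cauchy_convergent convergent_def by blast
  then have "(\<lambda>n. ?u n x) \<longlonglongrightarrow> ennreal (l\<^sup>2)"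
    using x(1) by (auto simp: patch_def intro!: tendsto_intros)
  then have "ennreal (l\<^sup>2) = 0"
    using x(2) lim_imp_Liminf[OF trivial_limit_sequentially] by metis
  then have "l = 0" by (simp add: ennreal_eq_0_iff)
  then have "(\<lambda>n. dist (p n) (f x)) \<longlonglongrightarrow> 0" using l by simp
  then have "p \<longlonglongrightarrow> f x" by (rule tendsto_dist_iff[THEN iffD2])
  then show "\<exists>l\<in>UNIV. p \<longlonglongrightarrow> l" by blast
qed

end

end

theorem theorem4p15:
  fixes M :: "'m measure" and h :: "('m \<Rightarrow> 'n::metric_space) set"
  assumes "space M \<noteq> {}"
    and "h \<in> L0 M"
    and "\<not> purely_infinite M"
    and "separable_space (euclidean :: 'n topology)"
  shows "(global_NNC (L2 M h) (L2_dist M) \<longleftrightarrow> global_NNC (UNIV :: 'n set) dist) \<and>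
         (global_NPC (L2 M h) (L2_dist M) \<longleftrightarrow> global_NPC (UNIV :: 'n set) dist)"
proof -
  note sep = assms(4)
  obtain h\<^sub>0 :: "'m \<Rightarrow> 'n" where h\<^sub>0: "h\<^sub>0 \<in> borel_measurable M" "h = ae_rel M `` {h\<^sub>0}"
    using assms(2) unfolding L0_def quotient_def L0_maps_eq_borel_measurable[OF sep] by blast
  obtain A R where A: "A \<in> sets M" "0 < emeasure M A" "emeasure M A < \<infinity>"
      "\<And>x. x \<in> A \<Longrightarrow> dist undefined (h\<^sub>0 x) \<le> R"
    using set_of_positive_measure_near_constant[OF sep h\<^sub>0(1) assms(3), of undefined] by blast
  note from_L2 = complete_from_L2[OF sep h\<^sub>0(1) A] has_midpoints_from_L2[OF sep h\<^sub>0(1) A]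
    four_point_comparison_from_L2[OF sep h\<^sub>0(1) A]
  note to_L2 = mcomplete_L2[OF sep h\<^sub>0(1)] has_midpoints_L2[OF sep h\<^sub>0(1)]
    four_point_comparison_L2[OF sep h\<^sub>0(1)]
  have transfer: "(Metric_space.mcomplete (L2 M h) (L2_dist M) \<and> has_midpoints (L2 M h) (L2_dist M)
        \<and> four_point_comparison \<sigma> (L2 M h) (L2_dist M)) \<longleftrightarrow>
      (Metric_space.mcomplete (UNIV :: 'n set) dist \<and> has_midpoints (UNIV :: 'n set) dist
        \<and> four_point_comparison \<sigma> (UNIV :: 'n set) dist)" for \<sigma>
    unfolding h\<^sub>0(2) mcomplete_iff_complete using from_L2 to_L2 by blast
  have L2: "Metric_space (L2 M h) (L2_dist M)"
    unfolding h\<^sub>0(2) by (rule Metric_space_L2[OF sep h\<^sub>0(1)])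
  have N: "Metric_space (UNIV :: 'n set) dist" by (rule Met_TC.Metric_space_axioms)
  show ?thesis
    unfolding global_NNC_iff[OF L2] global_NPC_iff[OF L2] global_NNC_iff[OF N] global_NPC_iff[OF N]
    by (intro conjI transfer)
qed

end
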